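(* Let $\mathbb{F}_d$ be the finite field of order $d=p^r$ ($p$ prime, $r\ge 1$). Let $S, K, m_1,\dots,m_S$ be positive integers and let $\mathbf{V}_s\in\mathbb{F}_d^{K\times m_s}$, $s\in\{1,\dots,S\}$, be matrices with $\mathrm{rank}(\mathbf{V}_s)=m_s$ for every $s$ and $\mathrm{rank}([\mathbf{V}_1,\dots,\mathbf{V}_S])=K$ (so $m_s\le K\le\sum_{s} m_s$). Define $$c=\min_{\substack{\mathbf{P}_s\in\mathbb{F}_d^{m_s\times m_s},\ \det(\mathbf{P}_s)\neq 0,\\ s=1,\dots,S}}\ \mathrm{rank}\Big(\sum_{s=1}^S \mathbf{V}_s\mathbf{P}_s\mathbf{V}_s^T\Big).$$ Then, for the problem of linear computation over a quantum multiple access channel (LC-QMAC) given by $\mathbf{V}_1,\dots,\mathbf{V}_S$, the region $$\mathcal{D}_{\mathsf{LC}}=\Big\{\bm{\Delta}=(\Delta_1,\dots,\Delta_S)\in\mathbb{R}_+^S\ :\ 2\Delta_s\ge m_s \text{ for all } s\in\{1,\dots,S\},\ \ \sum_{s=1}^S 2\Delta_s\ge \sum_{s=1}^S m_s+c\Big\}$$ is achievable; that is, every download cost tuple $\bm{\Delta}\in\mathcal{D}_{\mathsf{LC}}$ is achievable. Consequently, the computation rate $$R_{\mathsf{LC}}=\frac{2K}{\sum_{s=1}^S m_s+c}$$ is achievable.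
   Context: LC-QMAC problem. There are $S$ servers and one user. For an integer $L\ge1$, server $s$ stores $L$ instances of a classical data stream, $W_s^{[L]}=[W_s^{(1)},\dots,W_s^{(L)}]$ with $W_s^{(\ell)}\in\mathbb{F}_d^{m_s\times 1}$ arbitrary. The user wants, for each $\ell\in\{1,\dots,L\}$, the vector $$Y^{(\ell)}=\mathbf{V}_1W_1^{(\ell)}+\dots+\mathbf{V}_SW_S^{(\ell)}\in\mathbb{F}_d^{K\times1}.$$ Communication scheme (for $L$ instances with subsystem dimensions $\delta_1,\dots,\delta_S$, which are positive integers). (1) Server $s$ holds a quantum subsystem $\mathcal{Q}_s$, a complex Hilbert space of dimension $\delta_s$. The servers share an initial state (density matrix) $\rho^{\mathrm{ini}}$ on $\mathcal{Q}_1\otimes\dots\otimes\mathcal{Q}_S$, possibly entangled and independent of the data. (2) Server $s$ applies to $\mathcal{Q}_s$ a unitary $U_s$ that is a function only of $W_s^{[L]}$, so the state becomes $\rho^{\mathrm{enc}}=(U_1\otimes\dots\otimes U_S)\rho^{\mathrm{ini}}(U_1^\dagger\otimes\dots\otimes U_S^\dagger)$. All subsystems are then sent noiselessly to the user. (3) The user performs a POVM on the composite system, the same for all data values, and from its outcome determines $Y^{[L]}=[Y^{(1)},\dots,Y^{(L)}]$. The scheme is successful if, for all data values, $Y^{[L]}$ is recovered correctly with certainty. Download cost tuples. The normalized download cost tuple of such a scheme is $\bm{\Delta}=(\Delta_1,\dots,\Delta_S)$ with $\Delta_s=\frac{\log_d\delta_s}{L}$. Thus a download cost tuple is always a tuple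 of the form $\big(\frac{\log_d\delta_1}{L},\dots,\frac{\log_d\delta_S}{L}\big)$ for some positive integers $L,\delta_1,\dots,\delta_S$. Achievability. A download cost tuple $\bm{\Delta}$ is achievable if there exist an integer $L\ge1$ and a successful communication scheme for $L$ instances in which exactly $L\Delta_s$ qudits are downloaded from server $s$, i.e. $\log_d\delta_s=L\Delta_s$ for every $s$ (this $L$ need not be the one used to represent $\bm{\Delta}$ in the form above). A region in $\mathbb{R}_+^S$ is achievable if every download cost tuple in it is achievable. The computation rate of a tuple $\bm{\Delta}$ is $K/\sum_{s}\Delta_s$, and a rate is achievable if it is the rate of some achievable tuple. *)

theory Defs
  imports
    "HOL-Library.Cardinality"
    "Jordan_Normal_Form.DL_Rank"
    "Jordan_Normal_Form.Schur_Decomposition"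
begin

text \<open>Servers are indexed by \<open>s < S\<close>. A family indexed by servers is a function on
  \<^typ>\<open>nat\<close> whose values at \<open>s \<ge> S\<close> are never inspected. The field is a type
  \<open>'a :: {finite,field}\<close>, its order \<open>d\<close> is \<open>CARD('a)\<close>.\<close>

definition mat_sum :: "nat \<Rightarrow> nat \<Rightarrow> ('i \<Rightarrow> 'b::comm_monoid_add mat) \<Rightarrow> 'i set \<Rightarrow> 'b mat" where
  "mat_sum nr nc A I = mat nr nc (\<lambda>ij. \<Sum>k\<in>I. A k $$ ij)"

definition mat_trace :: "'b::comm_monoid_add mat \<Rightarrow> 'b" where
  "mat_trace A = (\<Sum>i<dim_row A. A $$ (i, i))"

definition kron :: "'b::times mat \<Rightarrow> 'b mat \<Rightarrow> 'b mat" where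
  "kron A B = mat (dim_row A * dim_row B) (dim_col A * dim_col B)
     (\<lambda>(i, j). A $$ (i div dim_row B, j div dim_col B) * B $$ (i mod dim_row B, j mod dim_col B))"

definition tensor_all :: "nat \<Rightarrow> (nat \<Rightarrow> 'b::semiring_1 mat) \<Rightarrow> 'b mat" where
  "tensor_all S A = foldr (\<lambda>s B. kron (A s) B) [0..<S] (1\<^sub>m 1)"

definition hconcat :: "nat \<Rightarrow> nat \<Rightarrow> (nat \<Rightarrow> 'b mat) \<Rightarrow> 'b mat" where
  "hconcat K S V = mat_of_cols K (concat (map (\<lambda>s. cols (V s)) [0..<S]))"

definition unitary_mat :: "nat \<Rightarrow> complex mat \<Rightarrow> bool" where
  "unitary_mat n U \<longleftrightarrow> U \<in> carrier_mat n n \<and> mat_adjoint U * U = 1\<^sub>m n \<and> U * mat_adjoint U = 1\<^sub>m n"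

definition psd_mat :: "nat \<Rightarrow> complex mat \<Rightarrow> bool" where
  "psd_mat n A \<longleftrightarrow> A \<in> carrier_mat n n \<and> mat_adjoint A = A \<and>
     (\<forall>v \<in> carrier_vec n. Re ((A *\<^sub>v v) \<bullet>c v) \<ge> 0)"

definition density_mat :: "nat \<Rightarrow> complex mat \<Rightarrow> bool" where
  "density_mat n \<rho> \<longleftrightarrow> psd_mat n \<rho> \<and> mat_trace \<rho> = 1"

definition is_povm :: "nat \<Rightarrow> nat \<Rightarrow> (nat \<Rightarrow> complex mat) \<Rightarrow> bool" where
  "is_povm n N M \<longleftrightarrow> (\<forall>i<N. psd_mat n (M i)) \<and> mat_sum n n M {..<N} = 1\<^sub>m n"

text \<open>The \<open>L\<close> instances of the stream of server \<open>s\<close> form the \<open>m s \<times> L\<close> matrix \<open>W s\<close> whose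
  \<open>l\<close>-th column is the \<open>l\<close>-th instance; the \<open>l\<close>-th column of the output below is then
  the value wanted by the user for instance \<open>l\<close>.\<close>

definition lc_output :: "nat \<Rightarrow> nat \<Rightarrow> (nat \<Rightarrow> 'a::field mat) \<Rightarrow> nat \<Rightarrow> (nat \<Rightarrow> 'a mat) \<Rightarrow> 'a mat" where
  "lc_output S K V L W = mat_sum K L (\<lambda>s. V s * W s) {..<S}"

definition encoded_state ::
  "nat \<Rightarrow> complex mat \<Rightarrow> (nat \<Rightarrow> 'a mat \<Rightarrow> complex mat) \<Rightarrow> (nat \<Rightarrow> 'a mat) \<Rightarrow> complex mat" where
  "encoded_state S \<rho> U W =
     tensor_all S (\<lambda>s. U s (W s)) * \<rho> * tensor_all S (\<lambda>s. mat_adjoint (U s (W s)))"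

text \<open>\<open>\<delta> s\<close> is the dimension of the subsystem of server \<open>s\<close>, \<open>\<rho>\<close> the shared initial state,
  \<open>U s\<close> the encoder of server \<open>s\<close>, \<open>M\<close> a POVM with outcomes \<open>i < N\<close>, and \<open>dec\<close> the map from
  outcomes to the output determined by the user. Certainty means that, for all data, the outcomes
  decoded to the correct output have total probability one.\<close>

definition successful_scheme ::
  "nat \<Rightarrow> nat \<Rightarrow> (nat \<Rightarrow> nat) \<Rightarrow> (nat \<Rightarrow> 'a::field mat) \<Rightarrow> nat \<Rightarrow> (nat \<Rightarrow> nat) \<Rightarrow> complex mat \<Rightarrow>
   (nat \<Rightarrow> 'a mat \<Rightarrow> complex mat) \<Rightarrow> nat \<Rightarrow> (nat \<Rightarrow> complex mat) \<Rightarrow> (nat \<Rightarrow> 'a mat) \<Rightarrow> bool" where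
  "successful_scheme S K m V L \<delta> \<rho> U N M dec \<longleftrightarrow>
     (\<forall>s<S. 0 < \<delta> s) \<and>
     density_mat (\<Prod>s<S. \<delta> s) \<rho> \<and>
     (\<forall>s<S. \<forall>w \<in> carrier_mat (m s) L. unitary_mat (\<delta> s) (U s w)) \<and>
     is_povm (\<Prod>s<S. \<delta> s) N M \<and>
     (\<forall>W. (\<forall>s<S. W s \<in> carrier_mat (m s) L) \<longrightarrow>
        (\<Sum>i | i < N \<and> dec i = lc_output S K V L W. mat_trace (M i * encoded_state S \<rho> U W)) = 1)"

definition download_cost_tuple :: "nat \<Rightarrow> nat \<Rightarrow> (nat \<Rightarrow> real) \<Rightarrow> bool" where
  "download_cost_tuple d S \<Delta> \<longleftrightarrow>
     (\<exists>L \<delta>. 1 \<le> L \<and> (\<forall>s<S. 0 < \<delta> s \<and> \<Delta> s = log (real d) (real (\<delta> s :: nat)) / real (L :: nat)))"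

definition achievable_tuple ::
  "nat \<Rightarrow> nat \<Rightarrow> (nat \<Rightarrow> nat) \<Rightarrow> (nat \<Rightarrow> 'a::{finite,field} mat) \<Rightarrow> (nat \<Rightarrow> real) \<Rightarrow> bool" where
  "achievable_tuple S K m V \<Delta> \<longleftrightarrow>
     (\<exists>L \<delta> \<rho> U N M dec. 1 \<le> L \<and> successful_scheme S K m V L \<delta> \<rho> U N M dec \<and>
        (\<forall>s<S. log (real CARD('a)) (real (\<delta> s)) = real L * \<Delta> s))"

definition achievable_region ::
  "nat \<Rightarrow> nat \<Rightarrow> (nat \<Rightarrow> nat) \<Rightarrow> (nat \<Rightarrow> 'a::{finite,field} mat) \<Rightarrow> (nat \<Rightarrow> real) set \<Rightarrow> bool" where
  "achievable_region S K m V D \<longleftrightarrow>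
     (\<forall>\<Delta>\<in>D. download_cost_tuple CARD('a) S \<Delta> \<longrightarrow> achievable_tuple S K m V \<Delta>)"

text \<open>The positivity condition rules out the degenerate total cost \<open>0\<close>, for which division in HOL
  would return the rate \<open>0\<close>.\<close>

definition achievable_rate ::
  "nat \<Rightarrow> nat \<Rightarrow> (nat \<Rightarrow> nat) \<Rightarrow> (nat \<Rightarrow> 'a::{finite,field} mat) \<Rightarrow> real \<Rightarrow> bool" where
  "achievable_rate S K m V R \<longleftrightarrow>
     (\<exists>\<Delta>. download_cost_tuple CARD('a) S \<Delta> \<and> achievable_tuple S K m V \<Delta> \<and>
        0 < (\<Sum>s<S. \<Delta> s) \<and> R = real K / (\<Sum>s<S. \<Delta> s))"

definition c_ranks :: "nat \<Rightarrow> nat \<Rightarrow> (nat \<Rightarrow> nat) \<Rightarrow> (nat \<Rightarrow> 'a::field mat) \<Rightarrow> nat set" where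
  "c_ranks S K m V =
     {vec_space.rank K (mat_sum K K (\<lambda>s. V s * P s * transpose_mat (V s)) {..<S}) | P.
        \<forall>s<S. P s \<in> carrier_mat (m s) (m s) \<and> det (P s) \<noteq> 0}"

definition c_min :: "nat \<Rightarrow> nat \<Rightarrow> (nat \<Rightarrow> nat) \<Rightarrow> (nat \<Rightarrow> 'a::field mat) \<Rightarrow> nat" where
  "c_min S K m V = Min (c_ranks S K m V)"

lemma c_ranks_subset: "c_ranks S K m (V :: nat \<Rightarrow> 'a::field mat) \<subseteq> {..K}"
  unfolding c_ranks_def mat_sum_def by (auto intro!: vec_space.rank_le_nc)

lemma c_ranks_nonempty: "c_ranks S K m (V :: nat \<Rightarrow> 'a::field mat) \<noteq> {}"
  unfolding c_ranks_def by (auto intro!: exI[of _ "\<lambda>s. 1\<^sub>m (m s)"])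

lemma c_min_in: "c_min S K m (V :: nat \<Rightarrow> 'a::field mat) \<in> c_ranks S K m V"
  unfolding c_min_def
  by (intro Min_in finite_subset[OF c_ranks_subset] c_ranks_nonempty) simp

definition D_LC ::
  "nat \<Rightarrow> nat \<Rightarrow> (nat \<Rightarrow> nat) \<Rightarrow> (nat \<Rightarrow> 'a::field mat) \<Rightarrow> (nat \<Rightarrow> real) set" where
  "D_LC S K m V =
     {\<Delta>. (\<forall>s<S. 0 \<le> \<Delta> s) \<and> (\<forall>s<S. 2 * \<Delta> s \<ge> real (m s)) \<and>
          (\<Sum>s<S. 2 * \<Delta> s) \<ge> real (\<Sum>s<S. m s) + real (c_min S K m V)}"

definition R_LC :: "nat \<Rightarrow> nat \<Rightarrow> (nat \<Rightarrow> nat) \<Rightarrow> (nat \<Rightarrow> 'a::field mat) \<Rightarrow> real" where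
  "R_LC S K m V = 2 * real K / (real (\<Sum>s<S. m s) + real (c_min S K m V))"

end

theory Submission
  imports Defs "HOL-Number_Theory.Cong"
begin

text \<open>The scheme is a CSS stabiliser code in which the unencoded and the encoded states are normalised
  projections onto joint eigenspaces of a commuting family of generalised Pauli operators \<open>G A\<close>,
  indexed by matrices \<open>A\<close> over the field. Encoding the data multiplies \<open>G A\<close> by the character
  value \<open>\<chi> (mat_inner A Y)\<close>, where \<open>Y\<close> is the wanted output, so it shifts the eigenspace by
  \<open>Y\<close> and measuring the eigenspace reveals \<open>Y\<close>. With two instances per round, \<open>m s\<close> qudits of server
  \<open>s\<close> carry all its data; the Pauli operators on them fail to commute by
  \<open>\<Sum>s. V s * P s * (V s)\<^sup>T\<close>, and \<open>c\<close> further qudits, placed at arbitrary servers, repair this.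
  Arbitrary download cost tuples are reached by rounding high powers of the subsystem dimensions down to
  powers of \<open>d\<close>.\<close>

subsection \<open>Additive subgroups and characters of finite fields\<close>

text \<open>Superdense coding is the source of the factor 2: a qudit absorbs one field symbol as a
  phase and another as a shift, so \<open>2 * n\<close> instances need only \<open>n * m s\<close>
  data qudits at server \<open>s\<close>. The matrix \<open>P s\<close> is a change of coordinates
  in the X-type stabilisers, which the server undoes on its own by encoding with the inverse matrix;
  hence any invertible choice is allowed, and the best one defines \<open>c\<close>. An auxiliary
  qudit adds one rank-one term to the commutator, so the number needed per pair of instances is a
  rank. The obstacle is that a cost tuple prescribes the dimensions exactly, and these need not be
  powers of \<open>d\<close>. All Pauli operators therefore live on a corner of each subsystem:
  \<open>G 0\<close> is a projection instead of the identity, the encoders act as the identity off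
  the corner, and the measurement gets one more outcome. Only the corner is rounded; the subsystems
  keep their full dimension, so the cost is met exactly.\<close>

definition additive_subgroup :: "'a::ring_1 set \<Rightarrow> bool" where
  "additive_subgroup H \<longleftrightarrow> 0 \<in> H \<and> (\<forall>x\<in>H. \<forall>y\<in>H. x - y \<in> H)"

lemma additive_subgroup_diff: "additive_subgroup H \<Longrightarrow> x \<in> H \<Longrightarrow> y \<in> H \<Longrightarrow> x - y \<in> H"
  and additive_subgroup_zero: "additive_subgroup H \<Longrightarrow> 0 \<in> H"
  by (auto simp: additive_subgroup_def)

lemma additive_subgroup_uminus: "additive_subgroup H \<Longrightarrow> x \<in> H \<Longrightarrow> - x \<in> H"
  using additive_subgroup_diff[of H 0 x] additive_subgroup_zero[of H] by simp

lemma additive_subgroup_add: "additive_subgroup H \<Longrightarrow> x \<in> H \<Longrightarrow> y \<in> H \<Longrightarrow> x + y \<in> H"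
  using additive_subgroup_diff[of H x "- y"] additive_subgroup_uminus[of H y] by simp

lemma additive_subgroup_of_int_mult:
  assumes "additive_subgroup H" "x \<in> H"
  shows "of_int k * x \<in> H"
proof (induction k rule: int_induct[where k = 0])
  case base
  then show ?case using assms additive_subgroup_zero by simp
next
  case (step1 i)
  then show ?case using assms additive_subgroup_add by (simp add: distrib_right)
next
  case (step2 i)
  then show ?case using assms additive_subgroup_diff by (simp add: left_diff_distrib)
qed

lemma CHAR_finite_field_pos: "CHAR('a::{finite,field}) > 0"
  by (rule finite_imp_CHAR_pos) simp

lemma prime_CHAR_finite_field: "prime CHAR('a::{finite,field})"
  using prime_CHAR_semidom CHAR_finite_field_pos by blast

lemma of_int_eq_0_iff_CHAR: "of_int k = (0 :: 'a::{finite,field}) \<longleftrightarrow> int CHAR('a) dvd k"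
  by (rule of_int_eq_0_iff_char_dvd)

lemma of_int_inverse_mod_CHAR:
  assumes "of_int k \<noteq> (0 :: 'a::{finite,field})"
  obtains j where "of_int j * of_int k = (1 :: 'a)"
proof -
  have "\<not> int CHAR('a) dvd k"
    using assms by (simp add: of_int_eq_0_iff_CHAR)
  then have "coprime (int CHAR('a)) k"
    using prime_CHAR_finite_field[where 'a = 'a] by (intro prime_imp_coprime) auto
  then have "coprime k (int CHAR('a))" by (simp add: coprime_commute)
  then obtain j where "[k * j = 1] (mod int CHAR('a))"
    using cong_solve_coprime_int by blast
  then have "int CHAR('a) dvd k * j - 1" by (simp add: cong_iff_dvd_diff)
  then have "of_int (k * j - 1) = (0 :: 'a)" by (simp only: of_int_eq_0_iff_CHAR)
  then have "of_int j * of_int k = (1 :: 'a)" by (simp add: mult.commute)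
  then show ?thesis by (rule that)
qed

text \<open>An integer that is nonzero in the field is invertible modulo the characteristic, so
  otherwise \<open>x\<close> would be an integer multiple of an element of \<open>H\<close>.\<close>

lemma of_int_mult_notin:
  fixes x :: "'a::{finite,field}"
  assumes H: "additive_subgroup H" and x: "x \<notin> H" and k: "of_int k * x \<in> H"
  shows "int CHAR('a) dvd k"
proof (rule ccontr)
  assume "\<not> ?thesis"
  then have "of_int k \<noteq> (0::'a)" by (simp add: of_int_eq_0_iff_CHAR)
  then obtain j where "of_int j * of_int k = (1 :: 'a)" by (rule of_int_inverse_mod_CHAR)
  then have "of_int j * (of_int k * x) = x" by (simp add: mult.assoc[symmetric])
  then show False using additive_subgroup_of_int_mult[OF H k, of j] x by metis
qed

lemma additive_subgroup_adjoin:
  fixes x :: "'a::{finite,field}"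
  assumes H: "additive_subgroup H"
  shows "additive_subgroup {h + of_int k * x | h k. h \<in> H}"
  unfolding additive_subgroup_def
proof (intro conjI ballI)
  show "0 \<in> {h + of_int k * x | h k. h \<in> H}"
    using additive_subgroup_zero[OF H] by (force intro: exI[of _ "0::int"])
next
  fix y z assume "y \<in> {h + of_int k * x | h k. h \<in> H}" "z \<in> {h + of_int k * x | h k. h \<in> H}"
  then obtain h k h' k' where "y = h + of_int k * x" "z = h' + of_int k' * x" "h \<in> H" "h' \<in> H" by auto
  then have "y - z = (h - h') + of_int (k - k') * x \<and> h - h' \<in> H"
    using additive_subgroup_diff[OF H] by (simp add: algebra_simps)
  then show "y - z \<in> {h + of_int k * x | h k. h \<in> H}" by blast
qed

text \<open>The multiples of \<open>x\<close> by 0, ..., p - 1, with p the characteristic, represent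
  the cosets of \<open>H\<close> in the larger group, and they are distinct by
  \<open>of_int_mult_notin\<close>.\<close>

lemma card_additive_subgroup_adjoin:
  fixes x :: "'a::{finite,field}"
  assumes H: "additive_subgroup H" and x: "x \<notin> H"
  shows "card {h + of_int k * x | h k. h \<in> H} = card H * CHAR('a)"
proof -
  define p where "p = CHAR('a)"
  have p: "p > 0" unfolding p_def by (rule CHAR_finite_field_pos)
  have "{h + of_int k * x | h k. h \<in> H} = (\<lambda>(h, k). h + of_int k * x) ` (H \<times> {0..<int p})"
  proof (intro equalityI subsetI)
    fix y assume "y \<in> {h + of_int k * x | h k. h \<in> H}"
    then obtain h k where y: "y = h + of_int k * x" "h \<in> H" by auto
    have "of_int (k - k mod int p) = (0::'a)"
      unfolding of_int_eq_0_iff_CHAR p_def by (rule dvd_minus_mod)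
    then have "(of_int k :: 'a) = of_int (k mod int p)" by simp
    with y p show "y \<in> (\<lambda>(h, k). h + of_int k * x) ` (H \<times> {0..<int p})"
      by (auto intro!: image_eqI[of _ _ "(h, k mod int p)"])
  qed auto
  moreover have "inj_on (\<lambda>(h, k). h + of_int k * x) (H \<times> {0..<int p})"
  proof (rule inj_onI, clarify)
    fix h k h' k' assume *: "h \<in> H" "h' \<in> H" "k \<in> {0..<int p}" "k' \<in> {0..<int p}"
      and eq: "h + of_int k * x = h' + of_int k' * x"
    have "of_int (k - k') * x = h' - h" using eq by (simp add: algebra_simps)
    also have "\<dots> \<in> H" using * H additive_subgroup_diff by blast
    finally have "int p dvd k - k'" unfolding p_def by (rule of_int_mult_notin[OF H x])
    then have "k = k'" using * by (metis atLeastLessThan_iff mod_eq_dvd_iff mod_pos_pos_trivial)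
    then show "h = h' \<and> k = k'" using eq by simp
  qed
  ultimately show ?thesis by (simp add: card_image card_cartesian_product p_def)
qed

text \<open>Maximal subgroups are chosen by cardinality, so that adjoining one further element is
  refuted by counting.\<close>

lemma obtain_greatest_card:
  fixes A :: "'a::finite set"
  assumes "P A"
  obtains H where "P H" "\<And>H'. P H' \<Longrightarrow> card H' \<le> card H"
proof -
  have "card H' < Suc CARD('a)" for H' :: "'a set"
    by (simp add: card_mono less_Suc_eq_le)
  then have "\<exists>H. P H \<and> (\<forall>H'. P H' \<longrightarrow> card H' \<le> card H)"
    using ex_has_greatest_nat[of P A card "Suc CARD('a)"] assms by blast
  then show ?thesis using that by blast
qed

lemma CARD_field_gt_1: "1 < CARD('a::{finite,field})"
  using card_mono[of UNIV "{0, 1::'a}"] by simp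

text \<open>A largest subgroup among those of p-power order is the whole field, since adjoining an
  outside element would multiply its order by p.\<close>

lemma CARD_finite_field_eq_CHAR_power: "\<exists>r>0. CARD('a::{finite,field}) = CHAR('a) ^ r"
proof -
  define P where "P H \<longleftrightarrow> additive_subgroup H \<and> (\<exists>r. card H = CHAR('a) ^ r)" for H :: "'a set"
  have "P {0}" unfolding P_def additive_subgroup_def by (auto intro: exI[of _ 0])
  then obtain H where H: "P H" and max: "\<And>H'. P H' \<Longrightarrow> card H' \<le> card H"
    by (rule obtain_greatest_card) blast
  then obtain r where sub: "additive_subgroup H" and r: "card H = CHAR('a) ^ r" unfolding P_def by auto
  have "H = UNIV"
  proof (rule ccontr)
    assume "H \<noteq> UNIV"
    then obtain x where x: "x \<notin> H" by auto
    have "P {h + of_int k * x | h k. h \<in> H}"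
      unfolding P_def card_additive_subgroup_adjoin[OF sub x] r
      using additive_subgroup_adjoin[OF sub] by (auto intro: exI[of _ "Suc r"])
    from max[OF this] have "card H * CHAR('a) \<le> card H"
      unfolding card_additive_subgroup_adjoin[OF sub x] .
    moreover have "CHAR('a) > 1" using prime_gt_1_nat[OF prime_CHAR_finite_field] .
    moreover have "card H > 0" using r CHAR_finite_field_pos[where 'a='a] by simp
    ultimately show False by simp
  qed
  with r have "CARD('a) = CHAR('a) ^ r" by simp
  moreover have "CARD('a) > 1" by (rule CARD_field_gt_1)
  ultimately show ?thesis by (cases "r = 0") auto
qed

text \<open>Modulo a largest subgroup \<open>H\<close> that avoids 1, every element is congruent to
  an integer, so the quotient is Z/p and the exponential of that integer over p is a character. This
  takes the place of the field trace.\<close>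

lemma nontrivial_additive_character:
  obtains \<chi> :: "'a::{finite,field} \<Rightarrow> complex"
  where "\<And>x y. \<chi> (x + y) = \<chi> x * \<chi> y" "\<And>x. cnj (\<chi> x) = \<chi> (- x)" "\<chi> 0 = 1" "\<exists>x. \<chi> x \<noteq> 1"
proof -
  define p where "p = CHAR('a)"
  have p: "p > 1" unfolding p_def using prime_gt_1_nat[OF prime_CHAR_finite_field] .
  define P where "P H \<longleftrightarrow> additive_subgroup H \<and> 1 \<notin> H" for H :: "'a set"
  have "P {0}" unfolding P_def additive_subgroup_def by auto
  then obtain H where H: "P H" and max: "\<And>H'. P H' \<Longrightarrow> card H' \<le> card H"
    by (rule obtain_greatest_card) blast
  then have sub: "additive_subgroup H" and one: "1 \<notin> H" unfolding P_def by auto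
  \<comment> \<open>Adjoining \<open>x\<close> must bring in 1, say 1 = h + k x; here k is
    invertible modulo p, and dividing by it exhibits \<open>x\<close> as an integer modulo
    \<open>H\<close>.\<close>
  have ex: "\<exists>k. x - of_int k \<in> H" for x
  proof (cases "x \<in> H")
    case True
    then show ?thesis by (auto intro: exI[of _ 0])
  next
    case False
    have "\<not> P {h + of_int k * x | h k. h \<in> H}"
    proof
      assume "P {h + of_int k * x | h k. h \<in> H}"
      from max[OF this] have "card H * p \<le> card H"
        unfolding card_additive_subgroup_adjoin[OF sub False] p_def .
      moreover have "card H > 0" using additive_subgroup_zero[OF sub] by (auto simp: card_gt_0_iff)
      ultimately show False using p by simp
    qed
    then obtain h k where hk: "1 = h + of_int k * x" "h \<in> H"
      unfolding P_def using additive_subgroup_adjoin[OF sub, of x] by auto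
    with one have "of_int k \<noteq> (0::'a)" by auto
    then obtain j where j: "of_int j * of_int k = (1 :: 'a)" by (rule of_int_inverse_mod_CHAR)
    have "x - of_int j = x - of_int j * (h + of_int k * x)" using hk(1) by simp
    also have "\<dots> = - (of_int j * h)" using j by (simp add: distrib_left mult.assoc[symmetric])
    also have "\<dots> \<in> H"
      by (intro additive_subgroup_uminus additive_subgroup_of_int_mult sub hk)
    finally show ?thesis by blast
  qed
  define f where "f x = (SOME k. x - of_int k \<in> H)" for x
  have f: "x - of_int (f x) \<in> H" for x
    unfolding f_def using someI_ex[OF ex[of x]] .
  define \<chi> where "\<chi> x = cis (2 * pi * of_int (f x) / real p)" for x
  \<comment> \<open>The character value does not depend on which representing integer
    \<open>f\<close> selects.\<close>
  have \<chi>: "\<chi> x = cis (2 * pi * of_int k / real p)" if "x - of_int k \<in> H" for x k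
  proof -
    have "of_int (f x - k) * 1 = (x - of_int k) - (x - of_int (f x))" by simp
    also have "\<dots> \<in> H" using additive_subgroup_diff[OF sub that f] .
    finally have "int p dvd f x - k" unfolding p_def by (rule of_int_mult_notin[OF sub one])
    then obtain t where t: "f x = k + int p * t" by (auto simp: dvd_def algebra_simps)
    have "\<chi> x = cis (2 * pi * of_int k / real p + 2 * pi * of_int t)"
      unfolding \<chi>_def t using p by (simp add: field_simps)
    also have "\<dots> = cis (2 * pi * of_int k / real p)"
      by (simp add: cis_mult[symmetric])
    finally show ?thesis .
  qed
  show ?thesis
  proof
    show "\<chi> (x + y) = \<chi> x * \<chi> y" for x y
    proof -
      have "x + y - of_int (f x + f y) = (x - of_int (f x)) + (y - of_int (f y))" by simp
      also have "\<dots> \<in> H" using additive_subgroup_add[OF sub f f] .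
      finally have "\<chi> (x + y) = cis (2 * pi * of_int (f x + f y) / real p)" by (rule \<chi>)
      then show ?thesis unfolding \<chi>_def cis_mult by (simp add: add_divide_distrib distrib_left)
    qed
    show "cnj (\<chi> x) = \<chi> (- x)" for x
    proof -
      have "- x - of_int (- f x) = - (x - of_int (f x))" by simp
      also have "\<dots> \<in> H" using additive_subgroup_uminus[OF sub f] .
      finally have "\<chi> (- x) = cis (2 * pi * of_int (- f x) / real p)" by (rule \<chi>)
      then show ?thesis unfolding \<chi>_def by (simp add: cis_cnj)
    qed
    show "\<chi> 0 = 1" using \<chi>[of 0 0] additive_subgroup_zero[OF sub] by simp
    have "\<chi> 1 = cis (2 * pi / real p)" using \<chi>[of 1 1] additive_subgroup_zero[OF sub] by simp
    moreover have "cis (2 * pi / real p) \<noteq> 1"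
    proof
      assume "cis (2 * pi / real p) = 1"
      then have "cos (2 * pi / real p) = 1" by (metis cis.simps(1) one_complex.simps(1))
      then obtain t :: int where "2 * pi / real p = of_int t * 2 * pi"
        using cos_one_2pi_int by blast
      then have "1 = real_of_int t * real p" using p by (simp add: field_simps)
      then have "1 = t * int p" by (metis of_int_1 of_int_eq_iff of_int_mult of_int_of_nat_eq)
      then have "int p dvd 1" by (metis dvd_triv_right)
      then show False using p by simp
    qed
    ultimately show "\<exists>x. \<chi> x \<noteq> 1" by metis
  qed
qed

subsection \<open>Adjoints, traces and projections\<close>

lemma index_mat_adjoint:
  "i < dim_col A \<Longrightarrow> j < dim_row A \<Longrightarrow> mat_adjoint (A :: complex mat) $$ (i, j) = cnj (A $$ (j, i))"
  by (simp add: mat_adjoint_def mat_of_rows_index)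

lemma dim_mat_adjoint [simp]:
  "dim_row (mat_adjoint A) = dim_col A" "dim_col (mat_adjoint A) = dim_row A"
  by (simp_all add: mat_adjoint_def)

lemma mat_adjoint_carrier [simp]: "A \<in> carrier_mat n m \<Longrightarrow> mat_adjoint A \<in> carrier_mat m n"
  by (auto intro!: carrier_matI)

lemma mat_adjoint_add:
  assumes "A \<in> carrier_mat n k" "B \<in> carrier_mat n k"
  shows "mat_adjoint (A + B :: complex mat) = mat_adjoint A + mat_adjoint B"
  using assms by (intro eq_matI) (auto simp: index_mat_adjoint)

lemma mat_adjoint_minus:
  assumes "A \<in> carrier_mat n k" "B \<in> carrier_mat n k"
  shows "mat_adjoint (A - B :: complex mat) = mat_adjoint A - mat_adjoint B"
  using assms by (intro eq_matI) (auto simp: index_mat_adjoint)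

lemma mat_adjoint_smult: "mat_adjoint (c \<cdot>\<^sub>m A :: complex mat) = cnj c \<cdot>\<^sub>m mat_adjoint A"
  by (intro eq_matI) (auto simp: index_mat_adjoint)

lemma mat_adjoint_one [simp]: "mat_adjoint (1\<^sub>m n :: complex mat) = 1\<^sub>m n"
  by (intro eq_matI) (auto simp: index_mat_adjoint)

lemma index_mult_mat_sum:
  assumes "A \<in> carrier_mat n k" "B \<in> carrier_mat k m" "i < n" "j < m"
  shows "(A * B) $$ (i, j) = (\<Sum>l<k. A $$ (i, l) * B $$ (l, j))"
  using assms by (auto simp: scalar_prod_def atLeast0LessThan intro!: sum.cong)

lemma mat_trace_mult_comm:
  assumes "A \<in> carrier_mat n k" "B \<in> carrier_mat k n"
  shows "mat_trace (A * B) = mat_trace (B * A :: 'a::comm_semiring_0 mat)"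
proof -
  have "mat_trace (A * B) = (\<Sum>i<n. \<Sum>l<k. A $$ (i, l) * B $$ (l, i))"
    using assms unfolding mat_trace_def
    by (intro sum.cong) (auto simp del: index_mult_mat(1) simp: index_mult_mat_sum[OF assms])
  also have "\<dots> = (\<Sum>l<k. \<Sum>i<n. B $$ (l, i) * A $$ (i, l))"
    by (subst sum.swap) (simp add: mult.commute)
  also have "\<dots> = mat_trace (B * A)"
    using assms unfolding mat_trace_def
    by (intro sum.cong) (auto simp del: index_mult_mat(1) simp: index_mult_mat_sum[OF assms(2,1)])
  finally show ?thesis .
qed

lemma mat_trace_smult: "A \<in> carrier_mat n n \<Longrightarrow> mat_trace (c \<cdot>\<^sub>m A) = c * mat_trace (A :: 'a::semiring_0 mat)"
  by (auto simp: mat_trace_def sum_distrib_left intro!: sum.cong)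

text \<open>A projection equals \<open>A * mat_adjoint A\<close>, so its trace is its squared
  Frobenius norm. For nonzero \<open>A\<close> this is a positive number by which the projection can
  be normalised to a density matrix.\<close>

lemma mat_trace_projection:
  assumes "A \<in> carrier_mat n n" "mat_adjoint A = A" "A * A = (A :: complex mat)"
  shows "mat_trace A = of_real (\<Sum>i<n. \<Sum>j<n. (cmod (A $$ (i, j)))\<^sup>2)"
proof -
  have "mat_trace A = mat_trace (A * mat_adjoint A)" using assms by simp
  also have "\<dots> = (\<Sum>i<n. \<Sum>j<n. A $$ (i, j) * mat_adjoint A $$ (j, i))"
    using assms(1) unfolding mat_trace_def
    by (intro sum.cong) (auto simp del: index_mult_mat(1) simp: index_mult_mat_sum[of _ n n _ n])
  also have "\<dots> = (\<Sum>i<n. \<Sum>j<n. A $$ (i, j) * cnj (A $$ (i, j)))"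
    using assms(1) by (intro sum.cong) (auto simp: index_mat_adjoint)
  also have "\<dots> = of_real (\<Sum>i<n. \<Sum>j<n. (cmod (A $$ (i, j)))\<^sup>2)"
    by (simp only: complex_norm_square of_real_sum)
  finally show ?thesis .
qed

lemma mat_trace_projection_pos:
  assumes "A \<in> carrier_mat n n" "mat_adjoint A = A" "A * A = (A :: complex mat)" "A \<noteq> 0\<^sub>m n n"
  obtains t :: real where "t > 0" "mat_trace A = of_real t"
proof
  show "mat_trace A = of_real (\<Sum>i<n. \<Sum>j<n. (cmod (A $$ (i, j)))\<^sup>2)"
    by (rule mat_trace_projection) fact+
  have "\<exists>i<n. \<exists>j<n. A $$ (i, j) \<noteq> 0"
  proof (rule ccontr)
    assume "\<not> ?thesis"
    then have "A = 0\<^sub>m n n" using assms(1) by (intro eq_matI) auto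
    with assms(4) show False ..
  qed
  then obtain i j where ij: "i < n" "j < n" "A $$ (i, j) \<noteq> 0" by auto
  then have "0 < (\<Sum>j<n. (cmod (A $$ (i, j)))\<^sup>2)"
    by (intro sum_pos2[of _ j]) auto
  then show "0 < (\<Sum>i<n. \<Sum>j<n. (cmod (A $$ (i, j)))\<^sup>2)"
    by (rule sum_pos2[of _ i, rotated 2]) (use ij in \<open>auto intro: sum_nonneg\<close>)
qed

lemma cscalar_prod_adjoint:
  fixes A :: "complex mat"
  assumes "A \<in> carrier_mat n n" "v \<in> carrier_vec n" "w \<in> carrier_vec n"
  shows "(mat_adjoint A *\<^sub>v v) \<bullet>c w = v \<bullet>c (A *\<^sub>v w)"
proof -
  have "(mat_adjoint A *\<^sub>v v) \<bullet>c w = (\<Sum>i<n. \<Sum>k<n. cnj (A $$ (k, i)) * v $ k * cnj (w $ i))"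
    using assms by (auto simp: scalar_prod_def index_mat_adjoint sum_distrib_right atLeast0LessThan intro!: sum.cong)
  also have "\<dots> = (\<Sum>k<n. \<Sum>i<n. cnj (A $$ (k, i)) * v $ k * cnj (w $ i))" by (rule sum.swap)
  also have "\<dots> = v \<bullet>c (A *\<^sub>v w)"
    using assms by (auto simp: scalar_prod_def sum_distrib_left atLeast0LessThan mult_ac intro!: sum.cong)
  finally show ?thesis .
qed

text \<open>Moving one of the two factors of \<open>A = A * A\<close> to the other side of the inner
  product leaves the squared norm of \<open>A *\<^sub>v v\<close>.\<close>

lemma psd_mat_projection:
  assumes "A \<in> carrier_mat n n" "mat_adjoint A = A" "A * A = A"
  shows "psd_mat n A"
  unfolding psd_mat_def
proof (intro conjI ballI assms)
  fix v :: "complex vec" assume v: "v \<in> carrier_vec n"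
  have "(A *\<^sub>v v) \<bullet>c v = (mat_adjoint A *\<^sub>v (A *\<^sub>v v)) \<bullet>c v"
    using assms v by (simp add: assoc_mult_mat_vec[symmetric])
  also have "\<dots> = (A *\<^sub>v v) \<bullet>c (A *\<^sub>v v)"
    using assms v by (intro cscalar_prod_adjoint) auto
  finally have "(A *\<^sub>v v) \<bullet>c v = (A *\<^sub>v v) \<bullet>c (A *\<^sub>v v)" .
  moreover have "Re (u \<bullet>c u) \<ge> 0" for u :: "complex vec"
    by (auto simp: scalar_prod_def intro!: sum_nonneg add_nonneg_nonneg)
  ultimately show "0 \<le> Re ((A *\<^sub>v v) \<bullet>c v)" by simp
qed

lemma psd_mat_smult:
  assumes "psd_mat n A" "c \<ge> 0"
  shows "psd_mat n (of_real c \<cdot>\<^sub>m A)"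
  unfolding psd_mat_def
proof (intro conjI ballI)
  have A: "A \<in> carrier_mat n n" "mat_adjoint A = A" using assms by (auto simp: psd_mat_def)
  then show "of_real c \<cdot>\<^sub>m A \<in> carrier_mat n n" "mat_adjoint (of_real c \<cdot>\<^sub>m A) = of_real c \<cdot>\<^sub>m A"
    by (auto simp: mat_adjoint_smult)
  fix v :: "complex vec" assume v: "v \<in> carrier_vec n"
  then have "(of_real c \<cdot>\<^sub>m A *\<^sub>v v) \<bullet>c v = of_real c * ((A *\<^sub>v v) \<bullet>c v)"
    using A by (simp add: scalar_prod_def sum_distrib_left sum_distrib_right mult.assoc)
  then show "0 \<le> Re ((of_real c \<cdot>\<^sub>m A *\<^sub>v v) \<bullet>c v)"
    using assms v by (simp add: psd_mat_def)
qed

subsection \<open>Sums of matrices\<close>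

lemma mat_sum_carrier [simp]: "mat_sum n m A I \<in> carrier_mat n m"
  by (simp add: mat_sum_def)

lemma dim_mat_sum [simp]: "dim_row (mat_sum n m A I) = n" "dim_col (mat_sum n m A I) = m"
  by (simp_all add: mat_sum_def)

lemma index_mat_sum [simp]:
  "i < n \<Longrightarrow> j < m \<Longrightarrow> mat_sum n m A I $$ (i, j) = (\<Sum>k\<in>I. A k $$ (i, j))"
  by (simp add: mat_sum_def)

lemma mat_sum_cong: "I = J \<Longrightarrow> (\<And>k. k \<in> J \<Longrightarrow> A k = B k) \<Longrightarrow> mat_sum n m A I = mat_sum n m B J"
  by (auto simp: mat_sum_def intro!: eq_matI sum.cong)

lemma mat_sum_reindex_bij_betw:
  "bij_betw h I J \<Longrightarrow> mat_sum n m (\<lambda>k. A (h k)) I = mat_sum n m A J"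
  by (rule eq_matI) (auto simp: sum.reindex_bij_betw[of h I J "\<lambda>k. A k $$ _"])

lemma mult_mat_sum_right:
  fixes A :: "'a::comm_semiring_0 mat"
  assumes "A \<in> carrier_mat n k" "\<And>x. x \<in> I \<Longrightarrow> B x \<in> carrier_mat k m"
  shows "A * mat_sum k m B I = mat_sum n m (\<lambda>x. A * B x) I"
proof (rule eq_matI)
  fix i j assume *: "i < dim_row (mat_sum n m (\<lambda>x. A * B x) I)" "j < dim_col (mat_sum n m (\<lambda>x. A * B x) I)"
  have "(A * mat_sum k m B I) $$ (i, j) = (\<Sum>l<k. \<Sum>x\<in>I. A $$ (i, l) * B x $$ (l, j))"
    using * assms(1) by (subst index_mult_mat_sum[of _ n k _ m]) (auto simp: sum_distrib_left)
  also have "\<dots> = (\<Sum>x\<in>I. \<Sum>l<k. A $$ (i, l) * B x $$ (l, j))" by (rule sum.swap)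
  also have "\<dots> = (\<Sum>x\<in>I. (A * B x) $$ (i, j))"
    using * assms by (intro sum.cong refl) (subst index_mult_mat_sum[of _ n k _ m], auto)
  finally show "(A * mat_sum k m B I) $$ (i, j) = mat_sum n m (\<lambda>x. A * B x) I $$ (i, j)" using * by simp
qed (use assms in auto)

lemma mult_mat_sum_left:
  fixes A :: "'a::comm_semiring_0 mat"
  assumes "A \<in> carrier_mat k m" "\<And>x. x \<in> I \<Longrightarrow> B x \<in> carrier_mat n k"
  shows "mat_sum n k B I * A = mat_sum n m (\<lambda>x. B x * A) I"
proof (rule eq_matI)
  fix i j assume *: "i < dim_row (mat_sum n m (\<lambda>x. B x * A) I)" "j < dim_col (mat_sum n m (\<lambda>x. B x * A) I)"
  have "(mat_sum n k B I * A) $$ (i, j) = (\<Sum>l<k. \<Sum>x\<in>I. B x $$ (i, l) * A $$ (l, j))"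
    using * assms(1) by (subst index_mult_mat_sum[of _ n k _ m]) (auto simp: sum_distrib_right)
  also have "\<dots> = (\<Sum>x\<in>I. \<Sum>l<k. B x $$ (i, l) * A $$ (l, j))" by (rule sum.swap)
  also have "\<dots> = (\<Sum>x\<in>I. (B x * A) $$ (i, j))"
    using * assms by (intro sum.cong refl) (subst index_mult_mat_sum[of _ n k _ m], auto)
  finally show "(mat_sum n k B I * A) $$ (i, j) = mat_sum n m (\<lambda>x. B x * A) I $$ (i, j)" using * by simp
qed (use assms in auto)

lemma mat_adjoint_mat_sum:
  assumes "\<And>x. x \<in> I \<Longrightarrow> B x \<in> carrier_mat n m"
  shows "mat_adjoint (mat_sum n m B I :: complex mat) = mat_sum m n (\<lambda>x. mat_adjoint (B x)) I"
  by (rule eq_matI) (auto simp: index_mat_adjoint carrier_matD[OF assms])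

lemma mat_sum_const:
  "A \<in> carrier_mat n m \<Longrightarrow> mat_sum n m (\<lambda>_. A) I = of_nat (card I) \<cdot>\<^sub>m (A :: 'a::semiring_1 mat)"
  by (rule eq_matI) auto

subsection \<open>Tensor products\<close>

lemma dim_kron [simp]:
  "dim_row (kron A B) = dim_row A * dim_row B" "dim_col (kron A B) = dim_col A * dim_col B"
  by (simp_all add: kron_def)

lemma kron_carrier [simp]:
  "A \<in> carrier_mat a b \<Longrightarrow> B \<in> carrier_mat c d \<Longrightarrow> kron A B \<in> carrier_mat (a * c) (b * d)"
  by (auto intro!: carrier_matI)

lemma index_kron:
  "i < dim_row A * dim_row B \<Longrightarrow> j < dim_col A * dim_col B \<Longrightarrow>
   kron A B $$ (i, j) = A $$ (i div dim_row B, j div dim_col B) * B $$ (i mod dim_row B, j mod dim_col B)"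
  by (simp add: kron_def)

lemma div_mod_less_mult:
  assumes "i < a * (b :: nat)" shows "i div b < a" "i mod b < b"
  using assms by (simp_all add: less_mult_imp_div_less) (metis mod_less_divisor mult_0_right not_gr_zero not_less_zero)

text \<open>Reads an index below \<open>m * n\<close> as a pair of digits, which is how
  \<open>kron\<close> numbers its rows and columns.\<close>

lemma sum_div_mod:
  "(\<Sum>k<m * n. f (k div n) (k mod n)) = (\<Sum>i<m. \<Sum>j<n. f i (j :: nat) :: 'a::comm_monoid_add)"
proof -
  have "(\<Sum>k<m * n. f (k div n) (k mod n)) = (\<Sum>(i, j)\<in>{..<m} \<times> {..<n}. f i j)"
  proof (rule sum.reindex_bij_witness[where j = "\<lambda>k. (k div n, k mod n)" and i = "\<lambda>(i, j). i * n + j"])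
    fix p assume p: "p \<in> {..<m} \<times> {..<n}"
    then obtain i j where ij: "p = (i, j)" "i < m" "j < n" by auto
    then have "i * n + j < Suc i * n" by simp
    also have "\<dots> \<le> m * n" using ij by (intro mult_le_mono1) auto
    finally show "(case p of (i, j) \<Rightarrow> i * n + j) \<in> {..<m * n}" using ij by simp
    show "((case p of (i, j) \<Rightarrow> i * n + j) div n, (case p of (i, j) \<Rightarrow> i * n + j) mod n) = p"
      using ij by simp
  qed (auto simp: div_mod_less_mult)
  then show ?thesis by (simp add: sum.cartesian_product)
qed

lemma kron_mult:
  fixes A B C D :: "'a::comm_semiring_1 mat"
  assumes "A \<in> carrier_mat a b" "B \<in> carrier_mat a' b'" "C \<in> carrier_mat b c" "D \<in> carrier_mat b' c'"
  shows "kron A B * kron C D = kron (A * C) (B * D)"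
proof (rule eq_matI)
  fix i j assume "i < dim_row (kron (A * C) (B * D))" "j < dim_col (kron (A * C) (B * D))"
  then have ij: "i < a * a'" "j < c * c'" using assms by auto
  note * = div_mod_less_mult[OF ij(1)] div_mod_less_mult[OF ij(2)]
  have "(kron A B * kron C D) $$ (i, j) = (\<Sum>k<b * b'. kron A B $$ (i, k) * kron C D $$ (k, j))"
    using assms ij by (intro index_mult_mat_sum[of _ "a * a'" _ _ "c * c'"]) auto
  also have "\<dots> = (\<Sum>k<b * b'. (A $$ (i div a', k div b') * B $$ (i mod a', k mod b')) *
      (C $$ (k div b', j div c') * D $$ (k mod b', j mod c')))"
    using assms ij by (intro sum.cong refl) (auto simp: index_kron carrier_matD)
  also have "\<dots> = (\<Sum>k<b. \<Sum>l<b'. (A $$ (i div a', k) * B $$ (i mod a', l)) *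
      (C $$ (k, j div c') * D $$ (l, j mod c')))"
    by (rule sum_div_mod)
  also have "\<dots> = (\<Sum>k<b. A $$ (i div a', k) * C $$ (k, j div c')) *
      (\<Sum>l<b'. B $$ (i mod a', l) * D $$ (l, j mod c'))"
    by (simp add: sum_product mult_ac)
  also have "\<dots> = (A * C) $$ (i div a', j div c') * (B * D) $$ (i mod a', j mod c')"
    using * assms by (simp del: index_mult_mat(1) add: index_mult_mat_sum[of A a b C c] index_mult_mat_sum[of B a' b' D c'])
  also have "\<dots> = kron (A * C) (B * D) $$ (i, j)"
    using assms ij by (auto simp: index_kron carrier_matD simp del: index_mult_mat(1))
  finally show "(kron A B * kron C D) $$ (i, j) = kron (A * C) (B * D) $$ (i, j)" .
qed (use assms in auto)

lemma kron_adjoint: "mat_adjoint (kron A B :: complex mat) = kron (mat_adjoint A) (mat_adjoint B)"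
  by (rule eq_matI) (auto simp: index_kron index_mat_adjoint div_mod_less_mult)

lemma kron_smult: "kron (c \<cdot>\<^sub>m A) (d \<cdot>\<^sub>m B) = (c * d) \<cdot>\<^sub>m kron A (B :: 'a::comm_semiring_1 mat)"
  by (rule eq_matI) (auto simp: index_kron div_mod_less_mult mult_ac)

lemma kron_one: "kron (1\<^sub>m a) (1\<^sub>m b) = (1\<^sub>m (a * b) :: 'a::semiring_1 mat)"
proof (rule eq_matI)
  fix i j assume "i < dim_row (1\<^sub>m (a * b))" "j < dim_col (1\<^sub>m (a * b))"
  moreover have "(i div b = j div b \<and> i mod b = j mod b) = (i = j)" by (metis div_mult_mod_eq)
  ultimately show "kron (1\<^sub>m a) (1\<^sub>m b) $$ (i, j) = (1\<^sub>m (a * b) :: 'a mat) $$ (i, j)"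
    by (auto simp: index_kron div_mod_less_mult)
qed auto

text \<open>\<open>foldr\<close> consumes the first server, whereas induction on \<open>S\<close>
  would split off the last one; arbitrary lists make the inductions go through.\<close>

definition tensor_list :: "nat list \<Rightarrow> (nat \<Rightarrow> 'b::semiring_1 mat) \<Rightarrow> 'b mat" where
  "tensor_list xs A = foldr (\<lambda>s B. kron (A s) B) xs (1\<^sub>m 1)"

lemma tensor_list_simps [simp]:
  "tensor_list [] A = 1\<^sub>m 1" "tensor_list (x # xs) A = kron (A x) (tensor_list xs A)"
  by (simp_all add: tensor_list_def)

lemma tensor_list_carrier:
  "(\<And>s. s \<in> set xs \<Longrightarrow> A s \<in> carrier_mat (\<delta> s) (\<delta> s)) \<Longrightarrow>
    tensor_list xs A \<in> carrier_mat (prod_list (map \<delta> xs)) (prod_list (map \<delta> xs))"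
  by (induction xs) auto

lemma tensor_list_mult:
  fixes A B :: "nat \<Rightarrow> 'a::comm_semiring_1 mat"
  assumes "\<And>s. s \<in> set xs \<Longrightarrow> A s \<in> carrier_mat (\<delta> s) (\<delta> s)" "\<And>s. s \<in> set xs \<Longrightarrow> B s \<in> carrier_mat (\<delta> s) (\<delta> s)"
  shows "tensor_list xs A * tensor_list xs B = tensor_list xs (\<lambda>s. A s * B s)"
  using assms
proof (induction xs)
  case (Cons x xs)
  have "tensor_list (x # xs) A * tensor_list (x # xs) B =
      kron (A x * B x) (tensor_list xs A * tensor_list xs B)"
    unfolding tensor_list_simps using Cons.prems
    by (intro kron_mult[of _ "\<delta> x" "\<delta> x" _ "prod_list (map \<delta> xs)" "prod_list (map \<delta> xs)" _ "\<delta> x" _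
          "prod_list (map \<delta> xs)"] tensor_list_carrier) auto
  then show ?case using Cons by simp
qed simp

lemma tensor_list_adjoint:
  "mat_adjoint (tensor_list xs A :: complex mat) = tensor_list xs (\<lambda>s. mat_adjoint (A s))"
  by (induction xs) (auto simp: kron_adjoint)

lemma tensor_list_smult:
  "tensor_list xs (\<lambda>s. c s \<cdot>\<^sub>m A s) = prod_list (map c xs) \<cdot>\<^sub>m tensor_list xs (A :: nat \<Rightarrow> 'a::comm_semiring_1 mat)"
  by (induction xs) (auto simp: kron_smult intro!: eq_matI)

lemma tensor_list_one:
  "(\<And>s. s \<in> set xs \<Longrightarrow> A s = 1\<^sub>m (\<delta> s)) \<Longrightarrow>
    tensor_list xs A = (1\<^sub>m (prod_list (map \<delta> xs)) :: 'a::semiring_1 mat)"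
  by (induction xs) (auto simp: kron_one)

lemma tensor_list_index_0:
  assumes "\<And>s. s \<in> set xs \<Longrightarrow> A s \<in> carrier_mat (\<delta> s) (\<delta> s)" "\<And>s. s \<in> set xs \<Longrightarrow> 0 < \<delta> s"
  shows "tensor_list xs (A :: nat \<Rightarrow> 'a::comm_semiring_1 mat) $$ (0, 0) = prod_list (map (\<lambda>s. A s $$ (0, 0)) xs)"
  using assms
proof (induction xs)
  case (Cons x xs)
  have "tensor_list xs A \<in> carrier_mat (prod_list (map \<delta> xs)) (prod_list (map \<delta> xs))"
    using Cons.prems by (intro tensor_list_carrier) auto
  moreover have "prod_list (map \<delta> xs) > 0" using Cons.prems by (induction xs) auto
  moreover have "A x \<in> carrier_mat (\<delta> x) (\<delta> x)" "0 < \<delta> x" using Cons.prems by auto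
  ultimately have "kron (A x) (tensor_list xs A) $$ (0, 0) = A x $$ (0, 0) * tensor_list xs A $$ (0, 0)"
    by (subst index_kron) auto
  then show ?case using Cons by auto
qed simp

lemma prod_list_upt: "prod_list (map f [0..<S]) = (\<Prod>s<S. f s :: 'a::comm_monoid_mult)"
  by (induction S) (auto simp: mult.commute)

lemma tensor_all_eq: "tensor_all S A = tensor_list [0..<S] A"
  by (simp add: tensor_all_def tensor_list_def)

lemma tensor_all_carrier:
  "(\<And>s. s < S \<Longrightarrow> A s \<in> carrier_mat (\<delta> s) (\<delta> s)) \<Longrightarrow>
    tensor_all S A \<in> carrier_mat (\<Prod>s<S. \<delta> s) (\<Prod>s<S. \<delta> s)"
  using tensor_list_carrier[of "[0..<S]" A \<delta>] by (auto simp: tensor_all_eq prod_list_upt)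

lemma tensor_all_mult:
  fixes A B :: "nat \<Rightarrow> 'a::comm_semiring_1 mat"
  assumes "\<And>s. s < S \<Longrightarrow> A s \<in> carrier_mat (\<delta> s) (\<delta> s)" "\<And>s. s < S \<Longrightarrow> B s \<in> carrier_mat (\<delta> s) (\<delta> s)"
  shows "tensor_all S A * tensor_all S B = tensor_all S (\<lambda>s. A s * B s)"
  unfolding tensor_all_eq using assms by (intro tensor_list_mult[where \<delta> = \<delta>]) auto

lemma tensor_all_adjoint:
  "mat_adjoint (tensor_all S A :: complex mat) = tensor_all S (\<lambda>s. mat_adjoint (A s))"
  by (simp add: tensor_all_eq tensor_list_adjoint)

lemma tensor_all_smult:
  "tensor_all S (\<lambda>s. c s \<cdot>\<^sub>m A s) = (\<Prod>s<S. c s) \<cdot>\<^sub>m tensor_all S (A :: nat \<Rightarrow> 'a::comm_semiring_1 mat)"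
  by (simp add: tensor_all_eq tensor_list_smult prod_list_upt)

lemma tensor_all_one:
  "(\<And>s. s < S \<Longrightarrow> A s = 1\<^sub>m (\<delta> s)) \<Longrightarrow> tensor_all S A = (1\<^sub>m (\<Prod>s<S. \<delta> s) :: 'a::semiring_1 mat)"
  using tensor_list_one[of "[0..<S]" A \<delta>] by (simp add: tensor_all_eq prod_list_upt)

text \<open>The corner entry later certifies that a tensor product of operators is nonzero.\<close>

lemma tensor_all_index_0:
  assumes "\<And>s. s < S \<Longrightarrow> A s \<in> carrier_mat (\<delta> s) (\<delta> s)" "\<And>s. s < S \<Longrightarrow> 0 < \<delta> s"
  shows "tensor_all S (A :: nat \<Rightarrow> 'a::comm_semiring_1 mat) $$ (0, 0) = (\<Prod>s<S. A s $$ (0, 0))"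
  using tensor_list_index_0[of "[0..<S]" A \<delta>] assms by (simp add: tensor_all_eq prod_list_upt)

lemma tensor_all_cong: "(\<And>s. s < S \<Longrightarrow> A s = B s) \<Longrightarrow> tensor_all S A = tensor_all S B"
proof -
  have "(\<And>s. s \<in> set xs \<Longrightarrow> A s = B s) \<Longrightarrow> tensor_list xs A = tensor_list xs B" for xs
    by (induction xs) auto
  from this[of "[0..<S]"] show "(\<And>s. s < S \<Longrightarrow> A s = B s) \<Longrightarrow> tensor_all S A = tensor_all S B"
    by (simp add: tensor_all_eq)
qed

subsection \<open>Spectral projections of a representation\<close>

lemma finite_carrier_mat: "finite (carrier_mat n k :: 'a::finite mat set)"
proof (rule finite_subset)
  show "carrier_mat n k \<subseteq> mat n k ` (({..<n} \<times> {..<k}) \<rightarrow>\<^sub>E (UNIV :: 'a set))"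
  proof
    fix A :: "'a mat" assume "A \<in> carrier_mat n k"
    then have "A = mat n k (restrict (\<lambda>ij. A $$ ij) ({..<n} \<times> {..<k}))" by (intro eq_matI) auto
    then show "A \<in> mat n k ` (({..<n} \<times> {..<k}) \<rightarrow>\<^sub>E UNIV)" by auto
  qed
qed (intro finite_imageI finite_PiE; simp)

lemma card_carrier_mat_pos: "card (carrier_mat n k :: 'a::{finite,zero} mat set) > 0"
  using finite_carrier_mat[of n k, where 'a = 'a] zero_carrier_mat[of n k, where 'a = 'a]
  by (auto simp: card_gt_0_iff)

lemma bij_betw_add_carrier_mat:
  assumes "A \<in> carrier_mat n k"
  shows "bij_betw (\<lambda>B. A + B) (carrier_mat n k) (carrier_mat n k :: 'a::ab_group_add mat set)"
  by (rule bij_betwI[where g = "\<lambda>B. B - A"]) (use assms in \<open>auto intro!: eq_matI\<close>)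

lemma bij_betw_uminus_carrier_mat:
  "bij_betw uminus (carrier_mat n k) (carrier_mat n k :: 'a::ab_group_add mat set)"
  by (rule bij_betwI[where g = uminus]) (auto intro!: eq_matI)

text \<open>The trace form tr(A^T B). Composed with a nontrivial additive character it identifies
  the additive group of matrices with its dual.\<close>

definition mat_inner :: "'a::comm_semiring_0 mat \<Rightarrow> 'a mat \<Rightarrow> 'a" where
  "mat_inner A B = (\<Sum>i<dim_row A. \<Sum>j<dim_col A. A $$ (i, j) * B $$ (i, j))"

lemma mat_inner_add_left:
  "A \<in> carrier_mat n k \<Longrightarrow> B \<in> carrier_mat n k \<Longrightarrow> mat_inner (A + B) C = mat_inner A C + mat_inner B C"
  by (auto simp: mat_inner_def distrib_right sum.distrib)

lemma mat_inner_add_right: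
  "A \<in> carrier_mat n k \<Longrightarrow> C \<in> carrier_mat n k \<Longrightarrow> B \<in> carrier_mat n k \<Longrightarrow>
    mat_inner A (B + C) = mat_inner A B + mat_inner A C"
  by (auto simp: mat_inner_def distrib_left sum.distrib)

lemma mat_inner_uminus_left: "mat_inner (- A) B = - mat_inner A (B :: 'a::comm_ring mat)"
  by (auto simp: mat_inner_def sum_negf)

lemma mat_inner_zero_left [simp]: "mat_inner (0\<^sub>m n k) B = 0"
  by (auto simp: mat_inner_def)

locale additive_character =
  fixes \<chi> :: "'a::{finite,field} \<Rightarrow> complex"
  assumes add: "\<chi> (x + y) = \<chi> x * \<chi> y"
    and cnj: "cnj (\<chi> x) = \<chi> (- x)"
    and zero [simp]: "\<chi> 0 = 1"
    and nontrivial: "\<exists>x. \<chi> x \<noteq> 1"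
begin

lemma prod_eq: "(\<Prod>i\<in>I. \<chi> (f i)) = \<chi> (\<Sum>i\<in>I. f i)"
  by (induction I rule: infinite_finite_induct) (auto simp: add)

lemma uminus_mult: "\<chi> (- x) * \<chi> x = 1" "\<chi> x * \<chi> (- x) = 1"
  by (simp_all flip: add)

text \<open>Orthogonality of characters: shifting the summation variable by a matrix on which the
  character differs from 1 multiplies the sum by that value, so the sum vanishes.\<close>

lemma sum_mat_inner:
  assumes A: "A \<in> carrier_mat n k"
  shows "(\<Sum>B\<in>carrier_mat n k. \<chi> (mat_inner A B)) =
    (if A = 0\<^sub>m n k then of_nat (card (carrier_mat n k :: 'a mat set)) else 0)"
proof (cases "A = 0\<^sub>m n k")
  case False
  then obtain i j where ij: "i < n" "j < k" "A $$ (i, j) \<noteq> 0"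
    using A by (metis carrier_matD eq_matI index_zero_mat(1) index_zero_mat(2,3))
  obtain x where x: "\<chi> x \<noteq> 1" using nontrivial by auto
  \<comment> \<open>Supported on a single nonzero entry of \<open>A\<close> and scaled to have inner
    product \<open>x\<close> with \<open>A\<close>.\<close>
  define B0 where "B0 = mat n k (\<lambda>q. if q = (i, j) then x / A $$ (i, j) else 0)"
  have B0: "B0 \<in> carrier_mat n k" by (simp add: B0_def)
  have "mat_inner A B0 = (\<Sum>i'<n. \<Sum>j'<k. if i' = i \<and> j' = j then x else 0)"
    unfolding mat_inner_def B0_def using A ij by (intro sum.cong) auto
  also have "\<dots> = (\<Sum>i'<n. if i' = i then x else 0)"
    using ij by (intro sum.cong) auto
  also have "\<dots> = x" using ij by simp
  finally have *: "mat_inner A B0 = x" .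
  let ?s = "\<Sum>B\<in>carrier_mat n k. \<chi> (mat_inner A B)"
  have "?s = (\<Sum>B\<in>carrier_mat n k. \<chi> (mat_inner A (B0 + B)))"
    using sum.reindex_bij_betw[OF bij_betw_add_carrier_mat[OF B0], of "\<lambda>B. \<chi> (mat_inner A B)"] by simp
  also have "\<dots> = \<chi> x * ?s"
    unfolding sum_distrib_left by (intro sum.cong) (auto simp: mat_inner_add_right[OF A _ B0] * add)
  finally show ?thesis using x False by (simp add: mult_cancel_right1)
qed simp

end

text \<open>Multiplying the average by any \<open>G A\<close> merely permutes its summands, so the
  average absorbs itself. \<open>G\<close> may send 0 to a proper projection, in which case the
  image lies inside the range of that projection.\<close>

lemma group_average_projection:
  fixes G :: "'a::{finite,ring} mat \<Rightarrow> complex mat"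
  assumes G: "\<And>A. A \<in> carrier_mat n k \<Longrightarrow> G A \<in> carrier_mat D D"
    and mult: "\<And>A B. A \<in> carrier_mat n k \<Longrightarrow> B \<in> carrier_mat n k \<Longrightarrow> G A * G B = G (A + B)"
    and adj: "\<And>A. A \<in> carrier_mat n k \<Longrightarrow> mat_adjoint (G A) = G (- A)"
  defines "P \<equiv> (1 / of_nat (card (carrier_mat n k :: 'a mat set))) \<cdot>\<^sub>m mat_sum D D G (carrier_mat n k)"
  shows "P \<in> carrier_mat D D" "mat_adjoint P = P" "P * P = P"
proof -
  define N where "N = card (carrier_mat n k :: 'a mat set)"
  have N: "N > 0" unfolding N_def by (rule card_carrier_mat_pos)
  show P: "P \<in> carrier_mat D D" by (simp add: P_def)
  have "mat_adjoint (mat_sum D D G (carrier_mat n k)) = mat_sum D D (\<lambda>A. G (- A)) (carrier_mat n k)"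
    by (subst mat_adjoint_mat_sum) (auto intro!: mat_sum_cong simp: G adj)
  also have "\<dots> = mat_sum D D G (carrier_mat n k)"
    by (rule mat_sum_reindex_bij_betw) (rule bij_betw_uminus_carrier_mat)
  finally show "mat_adjoint P = P" by (simp add: P_def mat_adjoint_smult)
  have absorb: "G A * P = P" if A: "A \<in> carrier_mat n k" for A
  proof -
    have "G A * P = (1 / of_nat N) \<cdot>\<^sub>m (G A * mat_sum D D G (carrier_mat n k))"
      unfolding P_def N_def using G[OF A] by (intro mult_smult_distrib[of _ D D _ D]) auto
    also have "G A * mat_sum D D G (carrier_mat n k) = mat_sum D D (\<lambda>B. G A * G B) (carrier_mat n k)"
      using G A by (intro mult_mat_sum_right) auto
    also have "\<dots> = mat_sum D D (\<lambda>B. G (A + B)) (carrier_mat n k)"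
      using mult A by (intro mat_sum_cong) auto
    also have "\<dots> = mat_sum D D G (carrier_mat n k)"
      by (rule mat_sum_reindex_bij_betw) (rule bij_betw_add_carrier_mat[OF A])
    finally show ?thesis by (simp add: P_def N_def)
  qed
  have "P * P = (1 / of_nat N) \<cdot>\<^sub>m (mat_sum D D G (carrier_mat n k) * P)"
    unfolding N_def by (subst (1) P_def, rule mult_smult_assoc_mat[of _ D D _ D]) (use P in auto)
  also have "mat_sum D D G (carrier_mat n k) * P = mat_sum D D (\<lambda>A. G A * P) (carrier_mat n k)"
    using P G by (intro mult_mat_sum_left) auto
  also have "\<dots> = mat_sum D D (\<lambda>_. P) (carrier_mat n k :: 'a mat set)"
    using absorb by (intro mat_sum_cong) auto
  also have "\<dots> = of_nat N \<cdot>\<^sub>m P" using P by (simp add: mat_sum_const N_def)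
  also have "(1 / of_nat N) \<cdot>\<^sub>m \<dots> = P" using N P by (intro eq_matI) auto
  finally show "P * P = P" .
qed

context additive_character
begin

text \<open>The average of the representation twisted by a character: it projects onto the joint
  eigenspace on which \<open>G A\<close> acts as \<open>\<chi> (- mat_inner A Y)\<close>.\<close>

definition spectral_projection :: "nat \<Rightarrow> nat \<Rightarrow> nat \<Rightarrow> ('a mat \<Rightarrow> complex mat) \<Rightarrow> 'a mat \<Rightarrow> complex mat" where
  "spectral_projection D n k G Y = (1 / of_nat (card (carrier_mat n k :: 'a mat set))) \<cdot>\<^sub>m
     mat_sum D D (\<lambda>A. \<chi> (mat_inner A Y) \<cdot>\<^sub>m G A) (carrier_mat n k)"

lemma spectral_projection_carrier [simp]: "spectral_projection D n k G Y \<in> carrier_mat D D"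
  by (simp add: spectral_projection_def)

lemma spectral_projection_projection:
  assumes G: "\<And>A. A \<in> carrier_mat n k \<Longrightarrow> G A \<in> carrier_mat D D"
    and mult: "\<And>A B. A \<in> carrier_mat n k \<Longrightarrow> B \<in> carrier_mat n k \<Longrightarrow> G A * G B = G (A + B)"
    and adj: "\<And>A. A \<in> carrier_mat n k \<Longrightarrow> mat_adjoint (G A) = G (- A)"
  shows "mat_adjoint (spectral_projection D n k G Y) = spectral_projection D n k G Y"
    "spectral_projection D n k G Y * spectral_projection D n k G Y = spectral_projection D n k G Y"
proof -
  let ?G = "\<lambda>A. \<chi> (mat_inner A Y) \<cdot>\<^sub>m G A"
  have 1: "?G A \<in> carrier_mat D D" if "A \<in> carrier_mat n k" for A using G[OF that] by simp
  have 2: "?G A * ?G B = ?G (A + B)" if AB: "A \<in> carrier_mat n k" "B \<in> carrier_mat n k" for A B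
  proof -
    have "?G A * ?G B = (\<chi> (mat_inner A Y) * \<chi> (mat_inner B Y)) \<cdot>\<^sub>m (G A * G B)"
      using G[OF AB(1)] G[OF AB(2)] by (auto intro!: eq_matI simp: sum_distrib_left mult_ac)
    then show ?thesis using AB mult mat_inner_add_left[OF AB] add by simp
  qed
  have 3: "mat_adjoint (?G A) = ?G (- A)" if "A \<in> carrier_mat n k" for A
    using adj[OF that] by (simp add: mat_adjoint_smult cnj mat_inner_uminus_left)
  show "mat_adjoint (spectral_projection D n k G Y) = spectral_projection D n k G Y"
    "spectral_projection D n k G Y * spectral_projection D n k G Y = spectral_projection D n k G Y"
    unfolding spectral_projection_def using group_average_projection[of n k ?G D, OF 1 2 3] by auto
qed

text \<open>Summing over \<open>Y\<close> first, orthogonality of characters leaves only the term at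
  the zero matrix. The projections resolve \<open>G 0\<close>, which can be smaller than the
  identity.\<close>

lemma sum_spectral_projection:
  assumes G: "\<And>A. A \<in> carrier_mat n k \<Longrightarrow> G A \<in> carrier_mat D D"
  shows "mat_sum D D (spectral_projection D n k G) (carrier_mat n k) = G (0\<^sub>m n k)"
proof (rule eq_matI)
  have G0: "G (0\<^sub>m n k) \<in> carrier_mat D D" using G by auto
  then show "dim_row (mat_sum D D (spectral_projection D n k G) (carrier_mat n k)) = dim_row (G (0\<^sub>m n k))"
    "dim_col (mat_sum D D (spectral_projection D n k G) (carrier_mat n k)) = dim_col (G (0\<^sub>m n k))" by auto
  fix i j assume "i < dim_row (G (0\<^sub>m n k))" "j < dim_col (G (0\<^sub>m n k))"
  then have ij: "i < D" "j < D" using G0 by auto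
  define N where "N = card (carrier_mat n k :: 'a mat set)"
  have N: "N > 0" unfolding N_def by (rule card_carrier_mat_pos)
  let ?\<Lambda> = "carrier_mat n k :: 'a mat set"
  have "mat_sum D D (spectral_projection D n k G) ?\<Lambda> $$ (i, j) =
      (\<Sum>Y\<in>?\<Lambda>. 1 / of_nat N * (\<Sum>A\<in>?\<Lambda>. \<chi> (mat_inner A Y) * G A $$ (i, j)))"
    using ij by (auto simp: spectral_projection_def N_def carrier_matD[OF G])
  also have "\<dots> = 1 / of_nat N * (\<Sum>Y\<in>?\<Lambda>. \<Sum>A\<in>?\<Lambda>. \<chi> (mat_inner A Y) * G A $$ (i, j))"
    by (simp add: sum_distrib_left)
  also have "\<dots> = 1 / of_nat N * (\<Sum>A\<in>?\<Lambda>. (\<Sum>Y\<in>?\<Lambda>. \<chi> (mat_inner A Y)) * G A $$ (i, j))"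
    by (subst sum.swap) (simp add: sum_distrib_right)
  also have "\<dots> = 1 / of_nat N * (\<Sum>A\<in>?\<Lambda>. if A = 0\<^sub>m n k then of_nat N * G A $$ (i, j) else 0)"
    by (intro arg_cong2[where f = times] sum.cong refl) (auto simp: sum_mat_inner N_def)
  also have "\<dots> = G (0\<^sub>m n k) $$ (i, j)"
    using N finite_carrier_mat[of n k, where 'a = 'a] by (simp add: sum.delta)
  finally show "mat_sum D D (spectral_projection D n k G) ?\<Lambda> $$ (i, j) = G (0\<^sub>m n k) $$ (i, j)" .
qed

text \<open>A conjugation that multiplies each \<open>G A\<close> by a character value only changes
  the twist in the average; this is how data move the label of the eigenspace.\<close>

lemma conjugate_spectral_projection:
  assumes G: "\<And>A. A \<in> carrier_mat n k \<Longrightarrow> G A \<in> carrier_mat D D"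
    and U: "U \<in> carrier_mat D D" "U' \<in> carrier_mat D D"
    and Y: "Y \<in> carrier_mat n k" "Y' \<in> carrier_mat n k"
    and conj: "\<And>A. A \<in> carrier_mat n k \<Longrightarrow> U * G A * U' = \<chi> (mat_inner A Y') \<cdot>\<^sub>m G A"
  shows "U * spectral_projection D n k G Y * U' = spectral_projection D n k G (Y + Y')"
proof -
  let ?c = "1 / of_nat (card (carrier_mat n k :: 'a mat set)) :: complex" and ?\<Lambda> = "carrier_mat n k :: 'a mat set"
  have "U * spectral_projection D n k G Y * U' =
      ?c \<cdot>\<^sub>m (U * mat_sum D D (\<lambda>A. \<chi> (mat_inner A Y) \<cdot>\<^sub>m G A) ?\<Lambda> * U')"
    unfolding spectral_projection_def using U
    by (simp add: mult_smult_distrib[of _ D D _ D] mult_smult_assoc_mat[of _ D D _ D])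
  also have "U * mat_sum D D (\<lambda>A. \<chi> (mat_inner A Y) \<cdot>\<^sub>m G A) ?\<Lambda> * U' =
      mat_sum D D (\<lambda>A. U * (\<chi> (mat_inner A Y) \<cdot>\<^sub>m G A) * U') ?\<Lambda>"
    using U G by (subst mult_mat_sum_right[of _ D], auto, subst mult_mat_sum_left[of _ D], auto)
  also have "\<dots> = mat_sum D D (\<lambda>A. \<chi> (mat_inner A (Y + Y')) \<cdot>\<^sub>m G A) ?\<Lambda>"
  proof (rule mat_sum_cong)
    fix A :: "'a mat" assume A: "A \<in> ?\<Lambda>"
    have "U * (\<chi> (mat_inner A Y) \<cdot>\<^sub>m G A) * U' = \<chi> (mat_inner A Y) \<cdot>\<^sub>m (U * G A * U')"
      using U G[OF A] by (simp add: mult_smult_distrib[of _ D D _ D] mult_smult_assoc_mat[of _ D D _ D])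
    also have "\<dots> = \<chi> (mat_inner A (Y + Y')) \<cdot>\<^sub>m G A"
      unfolding conj[OF A] mat_inner_add_right[OF A Y(2,1)] add
      by (intro eq_matI) (auto simp: mult.assoc)
    finally show "U * (\<chi> (mat_inner A Y) \<cdot>\<^sub>m G A) * U' = \<chi> (mat_inner A (Y + Y')) \<cdot>\<^sub>m G A" .
  qed simp
  finally show ?thesis by (simp add: spectral_projection_def)
qed

end

section \<open>From a representation to a successful scheme\<close>

lemma complement_projection:
  fixes P :: "complex mat"
  assumes P: "P \<in> carrier_mat d d" "P * P = P"
  shows "(1\<^sub>m d - P) * (1\<^sub>m d - P) = 1\<^sub>m d - P"
proof -
  have "(1\<^sub>m d - P) * (1\<^sub>m d - P) = 1\<^sub>m d * (1\<^sub>m d - P) - P * (1\<^sub>m d - P)"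
    using P by (intro minus_mult_distrib_mat[of _ d d]) (auto intro: minus_carrier_mat)
  also have "P * (1\<^sub>m d - P) = P * 1\<^sub>m d - P * P"
    using P by (intro mult_minus_distrib_mat[of _ d d]) auto
  also have "P * 1\<^sub>m d - P * P = 0\<^sub>m d d" using P by (auto intro!: eq_matI)
  finally show ?thesis using P by (auto intro!: eq_matI)
qed

lemma mat_adjoint_mult_unitary_tensor:
  assumes "\<And>s. s < S \<Longrightarrow> unitary_mat (\<delta> s) (U s)"
  shows "mat_adjoint (tensor_all S U) * tensor_all S U = 1\<^sub>m (\<Prod>s<S. \<delta> s)"
  unfolding tensor_all_adjoint
  by (subst tensor_all_mult[where \<delta> = \<delta>])
    (use assms in \<open>auto simp: unitary_mat_def intro!: tensor_all_one\<close>)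

context additive_character
begin

lemma successful_scheme_of_representation:
  assumes pos: "\<And>s. s < S \<Longrightarrow> 0 < \<delta> s"
    and G: "\<And>A. A \<in> carrier_mat K L \<Longrightarrow> G A \<in> carrier_mat (\<Prod>s<S. \<delta> s) (\<Prod>s<S. \<delta> s)"
    and mult: "\<And>A B. A \<in> carrier_mat K L \<Longrightarrow> B \<in> carrier_mat K L \<Longrightarrow> G A * G B = G (A + B)"
    and adj: "\<And>A. A \<in> carrier_mat K L \<Longrightarrow> mat_adjoint (G A) = G (- A)"
    and nz: "G (0\<^sub>m K L) \<noteq> 0\<^sub>m (\<Prod>s<S. \<delta> s) (\<Prod>s<S. \<delta> s)"
    and U: "\<And>s w. s < S \<Longrightarrow> w \<in> carrier_mat (m s) L \<Longrightarrow> unitary_mat (\<delta> s) (U s w)"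
    and conj: "\<And>W A. (\<And>s. s < S \<Longrightarrow> W s \<in> carrier_mat (m s) L) \<Longrightarrow> A \<in> carrier_mat K L \<Longrightarrow>
      tensor_all S (\<lambda>s. U s (W s)) * G A * mat_adjoint (tensor_all S (\<lambda>s. U s (W s))) =
      \<chi> (mat_inner A (lc_output S K V L W)) \<cdot>\<^sub>m G A"
  shows "\<exists>\<rho> N M dec. successful_scheme S K m V L \<delta> \<rho> U N M dec"
proof -
  let ?\<Lambda> = "carrier_mat K L :: 'a mat set"
  define D where "D = (\<Prod>s<S. \<delta> s)"
  define n where "n = card ?\<Lambda>"
  define P where "P = spectral_projection D K L G"
  note G = G[folded D_def] and nz = nz[folded D_def]
  have P: "P Y \<in> carrier_mat D D" "mat_adjoint (P Y) = P Y" "P Y * P Y = P Y" for Y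
    unfolding P_def using spectral_projection_projection[of K L G D Y, OF G mult adj] by auto
  have sumP: "mat_sum D D P ?\<Lambda> = G (0\<^sub>m K L)"
    unfolding P_def by (rule sum_spectral_projection) (rule G)
  have G0: "G (0\<^sub>m K L) \<in> carrier_mat D D" using G by auto
  have "- 0\<^sub>m K L = (0\<^sub>m K L :: 'a mat)" by (auto intro!: eq_matI)
  then have G0_adj: "mat_adjoint (G (0\<^sub>m K L)) = G (0\<^sub>m K L)"
    and G0_idem: "G (0\<^sub>m K L) * G (0\<^sub>m K L) = G (0\<^sub>m K L)"
    using adj[of "0\<^sub>m K L"] mult[of "0\<^sub>m K L" "0\<^sub>m K L"] by auto
  \<comment> \<open>Which labels have a nonzero eigenspace is not known, but the projections add up
    to the nonzero \<open>G 0\<close>, so some label \<open>Y0\<close> can serve as the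
    origin.\<close>
  have "\<exists>Y\<in>?\<Lambda>. P Y \<noteq> 0\<^sub>m D D"
  proof (rule ccontr)
    assume "\<not> ?thesis"
    then have "mat_sum D D P ?\<Lambda> = 0\<^sub>m D D" by (intro eq_matI) auto
    with sumP nz show False by simp
  qed
  then obtain Y0 where Y0: "Y0 \<in> ?\<Lambda>" "P Y0 \<noteq> 0\<^sub>m D D" by auto
  obtain t :: real where t: "t > 0" "mat_trace (P Y0) = of_real t"
    by (rule mat_trace_projection_pos[OF P Y0(2)])
  define \<rho> where "\<rho> = of_real (1 / t) \<cdot>\<^sub>m P Y0"
  obtain h where h: "bij_betw h {..<n} ?\<Lambda>"
    unfolding n_def using ex_bij_betw_nat_finite[OF finite_carrier_mat[of K L, where 'a = 'a]]
    by (auto simp: atLeast0LessThan)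
  define M where "M i = (if i < n then P (h i) else 1\<^sub>m D - G (0\<^sub>m K L))" for i
  \<comment> \<open>The additional outcome \<open>n\<close>, which completes the measurement off the
    range of \<open>G 0\<close>, is decoded to a matrix with \<open>Suc K\<close> rows. This is
    never an output, so each output is produced by exactly one outcome.\<close>
  define dec where "dec i = (if i < n then h i - Y0 else 0\<^sub>m (Suc K) L)" for i
  have "density_mat D \<rho>"
    unfolding density_mat_def \<rho>_def
  proof
    show "psd_mat D (of_real (1 / t) \<cdot>\<^sub>m P Y0)"
      using t(1) by (intro psd_mat_smult psd_mat_projection P) auto
    show "mat_trace (of_real (1 / t) \<cdot>\<^sub>m P Y0) = 1"
      using t P(1) by (simp add: mat_trace_smult[of _ D])
  qed
  moreover have "is_povm D (Suc n) M"
    unfolding is_povm_def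
  proof (intro conjI allI impI)
    fix i
    have "psd_mat D (1\<^sub>m D - G (0\<^sub>m K L))"
    proof (rule psd_mat_projection)
      show "(1\<^sub>m D - G (0\<^sub>m K L)) * (1\<^sub>m D - G (0\<^sub>m K L)) = 1\<^sub>m D - G (0\<^sub>m K L)"
        by (rule complement_projection[OF G0 G0_idem])
    qed (use G0 G0_adj in \<open>auto simp: minus_carrier_mat mat_adjoint_minus[of _ D D]\<close>)
    then show "psd_mat D (M i)"
      using psd_mat_projection[OF P] by (simp add: M_def)
  next
    have "mat_sum D D M {..<Suc n} = mat_sum D D (\<lambda>i. P (h i)) {..<n} + (1\<^sub>m D - G (0\<^sub>m K L))"
      using G0 by (intro eq_matI) (auto simp: M_def)
    also have "mat_sum D D (\<lambda>i. P (h i)) {..<n} = G (0\<^sub>m K L)"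
      using mat_sum_reindex_bij_betw[OF h, of D D P] sumP by simp
    also have "G (0\<^sub>m K L) + (1\<^sub>m D - G (0\<^sub>m K L)) = 1\<^sub>m D" using G0 by (intro eq_matI) auto
    finally show "mat_sum D D M {..<Suc n} = 1\<^sub>m D" .
  qed
  moreover have "(\<Sum>i | i < Suc n \<and> dec i = lc_output S K V L W. mat_trace (M i * encoded_state S \<rho> U W)) = 1"
    if W: "\<And>s. s < S \<Longrightarrow> W s \<in> carrier_mat (m s) L" for W
  proof -
    define Y where "Y = lc_output S K V L W"
    have Y: "Y \<in> ?\<Lambda>" by (simp add: Y_def lc_output_def)
    define T where "T = tensor_all S (\<lambda>s. U s (W s))"
    have unitary: "unitary_mat (\<delta> s) (U s (W s))" if "s < S" for s using U W that by simp
    have T: "T \<in> carrier_mat D D"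
      unfolding T_def D_def using unitary by (intro tensor_all_carrier) (auto simp: unitary_mat_def)
    have TT: "mat_adjoint T * T = 1\<^sub>m D"
      unfolding T_def D_def by (rule mat_adjoint_mult_unitary_tensor) (rule unitary)
    have conjP: "T * P Y0 * mat_adjoint T = P (Y0 + Y)"
      unfolding P_def
      by (rule conjugate_spectral_projection) (use G T Y0 Y conj[OF W] in \<open>auto simp: T_def Y_def\<close>)
    have enc: "encoded_state S \<rho> U W = of_real (1 / t) \<cdot>\<^sub>m P (Y0 + Y)"
      unfolding encoded_state_def \<rho>_def tensor_all_adjoint[symmetric] T_def[symmetric] conjP[symmetric]
      using T P(1) by (simp add: mult_smult_distrib[of _ D D _ D] mult_smult_assoc_mat[of _ D D _ D])
    \<comment> \<open>Unitary conjugation preserves the trace, so the constant \<open>t\<close> also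
      normalises the shifted projection, and the outcome labelled \<open>Y0 + Y\<close> has
      probability exactly 1.\<close>
    have "mat_trace (P (Y0 + Y)) = mat_trace (mat_adjoint T * (T * P Y0))"
      unfolding conjP[symmetric] using T P(1) by (intro mat_trace_mult_comm[of _ D D]) auto
    also have "mat_adjoint T * (T * P Y0) = P Y0"
      using T P(1)[of Y0] TT by (simp add: assoc_mult_mat[symmetric, of _ D D _ D _ D])
    finally have trace: "mat_trace (P (Y0 + Y)) = of_real t" using t by simp
    have "Y0 + Y \<in> ?\<Lambda>" using Y0 Y by auto
    then obtain i0 where i0: "i0 < n" "h i0 = Y0 + Y"
      using h by (metis bij_betw_iff_bijections lessThan_iff)
    have "{i. i < Suc n \<and> dec i = Y} = {i0}"
    proof (intro equalityI subsetI)
      fix i assume "i \<in> {i. i < Suc n \<and> dec i = Y}"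
      then have i: "i < Suc n" "dec i = Y" by auto
      have "i < n"
      proof (rule ccontr)
        assume "\<not> i < n"
        then have "dim_row Y = Suc K" using i by (auto simp: dec_def)
        then show False using Y by auto
      qed
      then have "h i \<in> ?\<Lambda>" "h i - Y0 = Y" using h i by (auto simp: dec_def bij_betw_def)
      then have "h i = h i0" using Y0(1) i0(2) by (auto intro!: eq_matI)
      then show "i \<in> {i0}" using h \<open>i < n\<close> i0 by (auto simp: bij_betw_def inj_on_def)
    next
      fix i assume "i \<in> {i0}"
      then show "i \<in> {i. i < Suc n \<and> dec i = Y}"
        using i0 Y Y0(1) by (auto simp: dec_def intro!: eq_matI)
    qed
    then have "(\<Sum>i | i < Suc n \<and> dec i = Y. mat_trace (M i * encoded_state S \<rho> U W)) =
        mat_trace (P (Y0 + Y) * (of_real (1 / t) \<cdot>\<^sub>m P (Y0 + Y)))"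
      using i0 by (simp add: M_def enc)
    also have "P (Y0 + Y) * (of_real (1 / t) \<cdot>\<^sub>m P (Y0 + Y)) = of_real (1 / t) \<cdot>\<^sub>m P (Y0 + Y)"
      using P by (simp add: mult_smult_distrib[of _ D D _ D])
    also have "mat_trace \<dots> = 1"
      using P(1) trace t(1) by (simp add: mat_trace_smult[of _ D])
    finally show ?thesis by (simp add: Y_def)
  qed
  ultimately have "successful_scheme S K m V L \<delta> \<rho> U (Suc n) M dec"
    unfolding successful_scheme_def D_def[symmetric] using pos U by auto
  then show ?thesis by blast
qed

section \<open>Pauli operators on a subsystem of arbitrary dimension\<close>

text \<open>Generalised Pauli operators \<open>|e\<rangle> \<mapsto> \<chi> (z \<cdot> e) |e + x\<rangle>\<close>, acting on the span of the first
  \<open>CARD('a) ^ card J\<close> basis vectors, which are labelled by the functions \<open>J \<rightarrow> 'a\<close>, and vanishing on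
  the remaining ones.\<close>

definition pauli_family :: "'j set \<Rightarrow> nat \<Rightarrow> (('j \<Rightarrow> 'a) \<Rightarrow> ('j \<Rightarrow> 'a) \<Rightarrow> complex mat) \<Rightarrow> bool" where
  "pauli_family J d T \<longleftrightarrow> (\<forall>x z. T x z \<in> carrier_mat d d) \<and>
     (\<forall>x z x' z'. T x z * T x' z' = \<chi> (\<Sum>t\<in>J. z t * x' t) \<cdot>\<^sub>m T (\<lambda>t. x t + x' t) (\<lambda>t. z t + z' t)) \<and>
     (\<forall>x z. mat_adjoint (T x z) = \<chi> (\<Sum>t\<in>J. z t * x t) \<cdot>\<^sub>m T (\<lambda>t. - x t) (\<lambda>t. - z t)) \<and>
     T (\<lambda>_. 0) (\<lambda>_. 0) $$ (0, 0) = 1"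

text \<open>An arbitrary enumeration \<open>e\<close> labels the first \<open>N\<close> basis
  vectors by functions. Labels are compared on \<open>J\<close> only, so \<open>x\<close> and
  \<open>z\<close> may take any values outside \<open>J\<close>.\<close>

lemma ex_pauli_family:
  fixes J :: "'j set"
  assumes J: "finite J" and le: "CARD('a) ^ card J \<le> d"
  shows "\<exists>T. pauli_family J d T"
proof -
  define N where "N = CARD('a) ^ card J"
  have N: "0 < N" "N \<le> d" using le by (auto simp: N_def)
  have "card (J \<rightarrow>\<^sub>E (UNIV :: 'a set)) = N" using J by (simp add: card_PiE N_def)
  moreover have "finite (J \<rightarrow>\<^sub>E (UNIV :: 'a set))" using J by (intro finite_PiE) auto
  ultimately obtain e where e: "bij_betw e {..<N} (J \<rightarrow>\<^sub>E (UNIV :: 'a set))"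
    using ex_bij_betw_nat_finite by (metis atLeast0LessThan)
  \<comment> \<open>The basis index whose label is that of \<open>j\<close> shifted by
    \<open>x\<close>.\<close>
  define sh where "sh x j = inv_into {..<N} e (restrict (\<lambda>t. e j t + x t) J)" for x :: "'j \<Rightarrow> 'a" and j
  have img: "restrict f J \<in> e ` {..<N}" for f :: "'j \<Rightarrow> 'a"
    using e by (auto simp: bij_betw_def)
  have sh: "sh x j < N" "e (sh x j) = restrict (\<lambda>t. e j t + x t) J" for x j
    unfolding sh_def using inv_into_into[OF img] f_inv_into_f[OF img] by auto
  have sh_iff: "(\<forall>t\<in>J. e i t = e j t + x t) \<longleftrightarrow> i = sh x j" if "i < N" for i j x
  proof
    assume *: "\<forall>t\<in>J. e i t = e j t + x t"
    have "e i \<in> J \<rightarrow>\<^sub>E UNIV" using e that by (auto simp: bij_betw_def)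
    then have "e i = e (sh x j)" unfolding sh using * by (auto simp: PiE_def extensional_def)
    then show "i = sh x j" using e that sh(1) by (auto simp: bij_betw_def inj_on_def)
  qed (simp add: sh)
  define T where "T x z = mat d d (\<lambda>(i, j). if i < N \<and> j < N \<and> (\<forall>t\<in>J. e i t = e j t + x t)
      then \<chi> (\<Sum>t\<in>J. z t * e j t) else 0)" for x z :: "'j \<Rightarrow> 'a"
  have T: "T x z \<in> carrier_mat d d" for x z by (simp add: T_def)
  have "pauli_family J d T"
    unfolding pauli_family_def
  proof (intro conjI allI)
    show "T x z \<in> carrier_mat d d" for x z by (rule T)
    show "T (\<lambda>_. 0) (\<lambda>_. 0) $$ (0, 0) = 1" using N by (simp add: T_def)
    show "mat_adjoint (T x z) = \<chi> (\<Sum>t\<in>J. z t * x t) \<cdot>\<^sub>m T (\<lambda>t. - x t) (\<lambda>t. - z t)" for x z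
    proof (rule eq_matI)
      fix i j assume "i < dim_row (\<chi> (\<Sum>t\<in>J. z t * x t) \<cdot>\<^sub>m T (\<lambda>t. - x t) (\<lambda>t. - z t))"
        "j < dim_col (\<chi> (\<Sum>t\<in>J. z t * x t) \<cdot>\<^sub>m T (\<lambda>t. - x t) (\<lambda>t. - z t))"
      then have ij: "i < d" "j < d" by (auto simp: T_def)
      have eq: "(\<forall>t\<in>J. e i t = e j t + - x t) \<longleftrightarrow> (\<forall>t\<in>J. e j t = e i t + x t)"
        by (auto simp: algebra_simps)
      have "cnj (\<chi> (\<Sum>t\<in>J. z t * e i t)) = \<chi> (\<Sum>t\<in>J. z t * x t) * \<chi> (\<Sum>t\<in>J. - z t * e j t)"
        if "\<forall>t\<in>J. e j t = e i t + x t"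
        unfolding cnj add[symmetric] sum.distrib[symmetric] sum_negf[symmetric] using that
        by (intro arg_cong[of _ _ \<chi>] sum.cong) (auto simp: algebra_simps)
      then show "mat_adjoint (T x z) $$ (i, j) =
          (\<chi> (\<Sum>t\<in>J. z t * x t) \<cdot>\<^sub>m T (\<lambda>t. - x t) (\<lambda>t. - z t)) $$ (i, j)"
        using ij eq by (subst index_mat_adjoint) (auto simp: T_def)
    qed (auto simp: T_def)
    show "T x z * T x' z' = \<chi> (\<Sum>t\<in>J. z t * x' t) \<cdot>\<^sub>m T (\<lambda>t. x t + x' t) (\<lambda>t. z t + z' t)" for x z x' z'
    proof (rule eq_matI)
      fix i j assume "i < dim_row (\<chi> (\<Sum>t\<in>J. z t * x' t) \<cdot>\<^sub>m T (\<lambda>t. x t + x' t) (\<lambda>t. z t + z' t))"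
        "j < dim_col (\<chi> (\<Sum>t\<in>J. z t * x' t) \<cdot>\<^sub>m T (\<lambda>t. x t + x' t) (\<lambda>t. z t + z' t))"
      then have ij: "i < d" "j < d" by (auto simp: T_def)
      let ?r = "(\<chi> (\<Sum>t\<in>J. z t * x' t) \<cdot>\<^sub>m T (\<lambda>t. x t + x' t) (\<lambda>t. z t + z' t)) $$ (i, j)"
      have "(T x z * T x' z') $$ (i, j) = (\<Sum>k<d. T x z $$ (i, k) * T x' z' $$ (k, j))"
        by (rule index_mult_mat_sum[OF T T ij])
      also have "\<dots> = ?r"
      proof (cases "j < N")
        case False
        then have "T x' z' $$ (k, j) = 0" if "k < d" for k using that ij by (simp add: T_def)
        then show ?thesis using False ij by (simp add: T_def)
      next
        case True
        \<comment> \<open>The second factor sends basis vector \<open>j\<close> to a multiple of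
          this one alone, so a single intermediate index contributes to the product.\<close>
        let ?k = "sh x' j"
        have k: "?k < d" using sh(1) N(2) by (rule less_le_trans)
        have "T x' z' $$ (k, j) = 0" if "k < d" "k \<noteq> ?k" for k
          using that ij sh_iff[of k j x'] by (auto simp: T_def)
        then have "(\<Sum>k<d. T x z $$ (i, k) * T x' z' $$ (k, j)) = T x z $$ (i, ?k) * T x' z' $$ (?k, j)"
          using k by (subst sum.remove[of _ ?k]) auto
        also have "T x' z' $$ (?k, j) = \<chi> (\<Sum>t\<in>J. z' t * e j t)"
          using k ij True sh by (simp add: T_def)
        also have "T x z $$ (i, ?k) * \<dots> = ?r"
        proof (cases "i < N \<and> (\<forall>t\<in>J. e i t = e j t + (x t + x' t))")
          case True
          then have "T x z $$ (i, ?k) = \<chi> (\<Sum>t\<in>J. z t * (e j t + x' t))"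
            using k ij sh by (auto simp: T_def algebra_simps intro!: arg_cong[of _ _ \<chi>] sum.cong)
          moreover have "?r = \<chi> (\<Sum>t\<in>J. z t * x' t) * \<chi> (\<Sum>t\<in>J. (z t + z' t) * e j t)"
            using True ij \<open>j < N\<close> by (simp add: T_def)
          moreover have "(\<Sum>t\<in>J. z t * (e j t + x' t)) + (\<Sum>t\<in>J. z' t * e j t) =
              (\<Sum>t\<in>J. z t * x' t) + (\<Sum>t\<in>J. (z t + z' t) * e j t)"
            unfolding sum.distrib[symmetric] by (intro sum.cong) (auto simp: algebra_simps)
          ultimately show ?thesis by (simp add: add[symmetric])
        next
          case False
          then have "T x z $$ (i, ?k) = 0" using k ij sh by (auto simp: T_def algebra_simps)
          moreover have "?r = 0" using False ij by (auto simp: T_def)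
          ultimately show ?thesis by simp
        qed
        finally show ?thesis .
      qed
      finally show "(T x z * T x' z') $$ (i, j) = ?r" .
    qed (auto simp: T_def)
  qed
  then show ?thesis by (rule exI[of _ T])
qed

text \<open>A Pauli operator is only a partial isometry, as it vanishes on the unlabelled basis
  vectors. Adding the projection onto these yields a unitary on the whole subsystem.\<close>

definition pauli_unitary ::
  "nat \<Rightarrow> (('j \<Rightarrow> 'a) \<Rightarrow> ('j \<Rightarrow> 'a) \<Rightarrow> complex mat) \<Rightarrow> ('j \<Rightarrow> 'a) \<Rightarrow> ('j \<Rightarrow> 'a) \<Rightarrow> complex mat" where
  "pauli_unitary d T x z = T x z + (1\<^sub>m d - T (\<lambda>_. 0) (\<lambda>_. 0))"

text \<open>The added projection \<open>R\<close> annihilates every Pauli operator from both sides,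
  so it drops out of the conjugation. What remains is the phase given by the symplectic product of
  \<open>(u, v)\<close> with \<open>(x, z)\<close>.\<close>

lemma pauli_unitary:
  fixes J :: "'j set"
  assumes "pauli_family J d T"
  shows "unitary_mat d (pauli_unitary d T u v)"
    and "pauli_unitary d T u v * T x z * mat_adjoint (pauli_unitary d T u v) =
      \<chi> (\<Sum>t\<in>J. v t * x t - z t * u t) \<cdot>\<^sub>m T x z"
proof -
  have T: "T x z \<in> carrier_mat d d"
    and mult: "T x z * T x' z' = \<chi> (\<Sum>t\<in>J. z t * x' t) \<cdot>\<^sub>m T (\<lambda>t. x t + x' t) (\<lambda>t. z t + z' t)"
    and adj: "mat_adjoint (T x z) = \<chi> (\<Sum>t\<in>J. z t * x t) \<cdot>\<^sub>m T (\<lambda>t. - x t) (\<lambda>t. - z t)" for x z x' z'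
    using assms by (auto simp: pauli_family_def)
  define E where "E = T (\<lambda>_. 0) (\<lambda>_. 0)"
  define R where "R = 1\<^sub>m d - E"
  define U where U_eq: "U = pauli_unitary d T"
  have U_def: "U x z = T x z + R" for x z by (simp add: U_eq pauli_unitary_def R_def E_def)
  have E: "E \<in> carrier_mat d d" by (simp add: E_def T)
  then have R: "R \<in> carrier_mat d d" by (simp add: R_def minus_carrier_mat)
  have U: "U x z \<in> carrier_mat d d" for x z using T R by (simp add: U_def)
  have one: "1 \<cdot>\<^sub>m A = A" for A :: "complex mat" by (auto intro!: eq_matI)
  have TE: "T x z * E = T x z" "E * T x z = T x z" for x z
    unfolding E_def mult by (simp_all add: one)
  have adjE: "mat_adjoint E = E" unfolding E_def adj by (simp add: one)
  then have adjR: "mat_adjoint R = R" using E by (simp add: R_def mat_adjoint_minus[of _ d d])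
  have zero: "A - A = 0\<^sub>m d d" if "A \<in> carrier_mat d d" for A :: "complex mat"
    using that by (auto intro!: eq_matI)
  have TR: "T x z * R = 0\<^sub>m d d" "R * T x z = 0\<^sub>m d d" for x z
    unfolding R_def using T[of x z] E TE[of x z]
    by (simp_all add: minus_mult_distrib_mat[of _ d d _ _ d] mult_minus_distrib_mat[of _ d d _ d] zero)
  have RR: "R * R = R"
    unfolding R_def by (rule complement_projection[OF E]) (use TE(1)[of "\<lambda>_. 0" "\<lambda>_. 0"] in \<open>simp add: E_def\<close>)
  have adjU: "mat_adjoint (U x z) = \<chi> (\<Sum>t\<in>J. z t * x t) \<cdot>\<^sub>m T (\<lambda>t. - x t) (\<lambda>t. - z t) + R" for x z
    unfolding U_def using T R by (simp add: mat_adjoint_add[of _ d d] adjR adj)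
  have UT: "U u v * T x z = T u v * T x z" for u v x z
    unfolding U_def using T R by (simp add: add_mult_distrib_mat[of _ d d _ _ d] TR right_add_zero_mat[OF mult_carrier_mat[OF T T]])
  have one_eq: "E + R = 1\<^sub>m d" using E by (auto simp: R_def intro!: eq_matI)
  have neg: "(\<Sum>t\<in>J. z t * - x t) = - (\<Sum>t\<in>J. z t * x t)" "(\<Sum>t\<in>J. - z t * x t) = - (\<Sum>t\<in>J. z t * x t)"
    for x z :: "'j \<Rightarrow> 'a" by (simp_all add: sum_negf)
  show "unitary_mat d (pauli_unitary d T u v)"
    unfolding unitary_mat_def U_eq[symmetric]
  proof (intro conjI)
    let ?T' = "\<chi> (\<Sum>t\<in>J. v t * u t) \<cdot>\<^sub>m T (\<lambda>t. - u t) (\<lambda>t. - v t)"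
    have T': "?T' \<in> carrier_mat d d" using T by simp
    have TT': "T u v * ?T' = E"
      using T by (simp add: mult_smult_distrib[of _ d d _ d] mult neg E_def)
        (auto intro!: eq_matI simp: sum_negf uminus_mult mult.assoc[symmetric])
    have T'T: "?T' * T u v = E"
      using T by (simp add: mult_smult_assoc_mat[of _ d d _ d] mult neg E_def)
        (auto intro!: eq_matI simp: sum_negf uminus_mult mult.assoc[symmetric])
    have T'R: "?T' * R = 0\<^sub>m d d" "R * ?T' = 0\<^sub>m d d"
      using T R by (simp_all add: mult_smult_distrib[of _ d d _ d] mult_smult_assoc_mat[of _ d d _ d] TR)
    have expand: "(A + R) * (B + R) = E + R" if "A \<in> carrier_mat d d" "B \<in> carrier_mat d d"
      "A * B = E" "A * R = 0\<^sub>m d d" "R * B = 0\<^sub>m d d" for A B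
      using that R E by (simp add: add_mult_distrib_mat[of _ d d _ _ d] mult_add_distrib_mat[of _ d d _ d] RR)
    show "U u v * mat_adjoint (U u v) = 1\<^sub>m d"
      unfolding adjU unfolding U_def using expand[OF T T' TT' TR(1) T'R(2)] one_eq by simp
    show "mat_adjoint (U u v) * U u v = 1\<^sub>m d"
      unfolding adjU unfolding U_def using expand[OF T' T T'T T'R(1) TR(2)] one_eq by simp
  qed (rule U)
  show "pauli_unitary d T u v * T x z * mat_adjoint (pauli_unitary d T u v) =
      \<chi> (\<Sum>t\<in>J. v t * x t - z t * u t) \<cdot>\<^sub>m T x z"
  proof -
    let ?c = "\<chi> (\<Sum>t\<in>J. v t * x t)"
    let ?A = "T (\<lambda>t. u t + x t) (\<lambda>t. v t + z t)"
    let ?B = "T (\<lambda>t. - u t) (\<lambda>t. - v t)" and ?b = "\<chi> (\<Sum>t\<in>J. v t * u t)"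
    have A: "?A \<in> carrier_mat d d" and B: "?B \<in> carrier_mat d d" by (rule T)+
    have "U u v * T x z * mat_adjoint (U u v) = (?c \<cdot>\<^sub>m ?A) * (?b \<cdot>\<^sub>m ?B + R)"
      unfolding UT mult adjU ..
    also have "\<dots> = (?c * ?b) \<cdot>\<^sub>m (?A * ?B)"
      using A B R TR(1)
      by (simp add: mult_add_distrib_mat[of _ d d _ d] mult_smult_assoc_mat[of _ d d _ d]
            mult_smult_distrib[of _ d d _ d]) (auto intro!: eq_matI)
    also have "?A * ?B = \<chi> (\<Sum>t\<in>J. (v t + z t) * - u t) \<cdot>\<^sub>m T x z"
      unfolding mult by simp
    also have "(?c * ?b) \<cdot>\<^sub>m \<dots> = \<chi> (\<Sum>t\<in>J. v t * x t - z t * u t) \<cdot>\<^sub>m T x z"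
    proof -
      have "?c * ?b * \<chi> (\<Sum>t\<in>J. (v t + z t) * - u t) = \<chi> (\<Sum>t\<in>J. v t * x t - z t * u t)"
        unfolding add[symmetric] sum.distrib[symmetric]
        by (intro arg_cong[of _ _ \<chi>] sum.cong) (auto simp: algebra_simps)
      then show ?thesis using T[of x z] by (auto intro!: eq_matI simp: mult.assoc[symmetric])
    qed
    finally show ?thesis unfolding U_eq .
  qed
qed

end

subsection \<open>Stabiliser codes\<close>

context additive_character
begin

text \<open>Server \<open>s\<close> holds the qudits \<open>J s\<close>, the
  stabiliser belonging to \<open>A\<close> acts on them as the Pauli operator \<open>(X s A, Z s A)\<close>, and the data
  \<open>w\<close> are encoded by \<open>(u s w, v s w)\<close>. The first identity makes the stabilisers an honest
  representation without sign corrections, so that characteristic 2 needs no special care.\<close>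

lemma successful_scheme_of_code:
  fixes J :: "nat \<Rightarrow> 'j set" and X Z u v :: "nat \<Rightarrow> 'a mat \<Rightarrow> 'j \<Rightarrow> 'a"
  assumes J: "\<And>s. s < S \<Longrightarrow> finite (J s)" "\<And>s. s < S \<Longrightarrow> CARD('a) ^ card (J s) \<le> \<delta> s"
    and X: "\<And>s A B t. A \<in> carrier_mat K L \<Longrightarrow> B \<in> carrier_mat K L \<Longrightarrow> X s (A + B) t = X s A t + X s B t"
    and Z: "\<And>s A B t. A \<in> carrier_mat K L \<Longrightarrow> B \<in> carrier_mat K L \<Longrightarrow> Z s (A + B) t = Z s A t + Z s B t"
    and commute: "\<And>A B. A \<in> carrier_mat K L \<Longrightarrow> B \<in> carrier_mat K L \<Longrightarrow>
      (\<Sum>s<S. \<Sum>t\<in>J s. Z s A t * X s B t) = 0"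
    and syndrome: "\<And>W A. (\<And>s. s < S \<Longrightarrow> W s \<in> carrier_mat (m s) L) \<Longrightarrow> A \<in> carrier_mat K L \<Longrightarrow>
      (\<Sum>s<S. \<Sum>t\<in>J s. v s (W s) t * X s A t - Z s A t * u s (W s) t) = mat_inner A (lc_output S K V L W)"
  shows "\<exists>\<rho> U N M dec. successful_scheme S K m V L \<delta> \<rho> U N M dec"
proof -
  have zero: "- 0\<^sub>m K L = (0\<^sub>m K L :: 'a mat)" "A + - A = 0\<^sub>m K L" if "A \<in> carrier_mat K L" for A :: "'a mat"
    using that by (auto intro!: eq_matI)
  have X0: "X s (0\<^sub>m K L) = (\<lambda>t. 0)" for s
    using X[of "0\<^sub>m K L" "0\<^sub>m K L" s] by (intro ext) (metis add_cancel_left_right right_add_zero_mat zero_carrier_mat)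
  have Z0: "Z s (0\<^sub>m K L) = (\<lambda>t. 0)" for s
    using Z[of "0\<^sub>m K L" "0\<^sub>m K L" s] by (intro ext) (metis add_cancel_left_right right_add_zero_mat zero_carrier_mat)
  have Xneg: "X s (- A) = (\<lambda>t. - X s A t)" if "A \<in> carrier_mat K L" for s A
  proof
    show "X s (- A) t = - X s A t" for t using X[of A "- A" s t] X0 zero that by (simp add: eq_neg_iff_add_eq_0 add.commute)
  qed
  have Zneg: "Z s (- A) = (\<lambda>t. - Z s A t)" if "A \<in> carrier_mat K L" for s A
  proof
    show "Z s (- A) t = - Z s A t" for t using Z[of A "- A" s t] Z0 zero that by (simp add: eq_neg_iff_add_eq_0 add.commute)
  qed
  have X_fun: "X s (A + B) = (\<lambda>t. X s A t + X s B t)" and Z_fun: "Z s (A + B) = (\<lambda>t. Z s A t + Z s B t)"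
    if "A \<in> carrier_mat K L" "B \<in> carrier_mat K L" for s A B
    using that by (auto simp: X Z)
  have pos: "0 < \<delta> s" if "s < S" for s
    by (rule less_le_trans[OF _ J(2)[OF that]]) simp
  have "\<forall>s. \<exists>T. s < S \<longrightarrow> pauli_family (J s) (\<delta> s) T"
    using ex_pauli_family[OF J] by blast
  then obtain T where T: "\<And>s. s < S \<Longrightarrow> pauli_family (J s) (\<delta> s) (T s)" by metis
  have T_carrier: "T s x z \<in> carrier_mat (\<delta> s) (\<delta> s)"
    and T_mult: "T s x z * T s x' z' = \<chi> (\<Sum>t\<in>J s. z t * x' t) \<cdot>\<^sub>m T s (\<lambda>t. x t + x' t) (\<lambda>t. z t + z' t)"
    and T_adj: "mat_adjoint (T s x z) = \<chi> (\<Sum>t\<in>J s. z t * x t) \<cdot>\<^sub>m T s (\<lambda>t. - x t) (\<lambda>t. - z t)"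
    and T_0: "T s (\<lambda>_. 0) (\<lambda>_. 0) $$ (0, 0) = 1" if "s < S" for s x z x' z'
    using T[OF that] by (auto simp: pauli_family_def)
  define G where "G A = tensor_all S (\<lambda>s. T s (X s A) (Z s A))" for A
  define U where "U s w = pauli_unitary (\<delta> s) (T s) (u s w) (v s w)" for s w
  have unitary: "unitary_mat (\<delta> s) (U s w)" if "s < S" for s w
    unfolding U_def by (rule pauli_unitary[OF T[OF that]])
  then have U_carrier: "U s w \<in> carrier_mat (\<delta> s) (\<delta> s)" if "s < S" for s w
    using that by (auto simp: unitary_mat_def)
  have one: "1 \<cdot>\<^sub>m A = A" for A :: "complex mat" by (auto intro!: eq_matI)
  have "\<exists>\<rho> N M dec. successful_scheme S K m V L \<delta> \<rho> U N M dec"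
  proof (rule successful_scheme_of_representation)
    show "0 < \<delta> s" if "s < S" for s by (rule pos[OF that])
    show "G A \<in> carrier_mat (\<Prod>s<S. \<delta> s) (\<Prod>s<S. \<delta> s)" for A
      unfolding G_def by (intro tensor_all_carrier T_carrier)
    show "G A * G B = G (A + B)" if AB: "A \<in> carrier_mat K L" "B \<in> carrier_mat K L" for A B
    proof -
      have "G A * G B = tensor_all S (\<lambda>s. T s (X s A) (Z s A) * T s (X s B) (Z s B))"
        unfolding G_def by (intro tensor_all_mult[where \<delta> = \<delta>] T_carrier)
      also have "\<dots> = tensor_all S (\<lambda>s. \<chi> (\<Sum>t\<in>J s. Z s A t * X s B t) \<cdot>\<^sub>m T s (X s (A + B)) (Z s (A + B)))"
        by (rule tensor_all_cong) (simp add: T_mult X_fun[OF AB] Z_fun[OF AB])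
      \<comment> \<open>The phases of the individual servers multiply to the character of the total
        sum, which \<open>commute\<close> makes 0.\<close>
      also have "\<dots> = G (A + B)"
        unfolding tensor_all_smult prod_eq commute[OF AB] by (simp add: one G_def)
      finally show ?thesis .
    qed
    show "mat_adjoint (G A) = G (- A)" if A: "A \<in> carrier_mat K L" for A
    proof -
      have "mat_adjoint (G A) = tensor_all S (\<lambda>s. \<chi> (\<Sum>t\<in>J s. Z s A t * X s A t) \<cdot>\<^sub>m T s (X s (- A)) (Z s (- A)))"
        unfolding G_def tensor_all_adjoint by (rule tensor_all_cong) (simp add: T_adj Xneg[OF A] Zneg[OF A])
      also have "\<dots> = G (- A)"
        unfolding tensor_all_smult prod_eq commute[OF A A] by (simp add: one G_def)
      finally show ?thesis .
    qed
    have "G (0\<^sub>m K L) $$ (0, 0) = (\<Prod>s<S. T s (X s (0\<^sub>m K L)) (Z s (0\<^sub>m K L)) $$ (0, 0))"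
      unfolding G_def by (rule tensor_all_index_0[of S _ \<delta>]) (simp_all add: T_carrier pos)
    also have "\<dots> = 1" unfolding X0 Z0 using T_0 by (intro prod.neutral) auto
    finally show "G (0\<^sub>m K L) \<noteq> 0\<^sub>m (\<Prod>s<S. \<delta> s) (\<Prod>s<S. \<delta> s)" using pos by (auto simp: prod_pos)
    show "unitary_mat (\<delta> s) (U s w)" if "s < S" for s w by (rule unitary[OF that])
    show "tensor_all S (\<lambda>s. U s (W s)) * G A * mat_adjoint (tensor_all S (\<lambda>s. U s (W s))) =
      \<chi> (mat_inner A (lc_output S K V L W)) \<cdot>\<^sub>m G A"
      if W: "\<And>s. s < S \<Longrightarrow> W s \<in> carrier_mat (m s) L" and A: "A \<in> carrier_mat K L" for W A
    proof -
      have "tensor_all S (\<lambda>s. U s (W s)) * G A * mat_adjoint (tensor_all S (\<lambda>s. U s (W s))) =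
          tensor_all S (\<lambda>s. U s (W s) * T s (X s A) (Z s A)) * tensor_all S (\<lambda>s. mat_adjoint (U s (W s)))"
        unfolding G_def tensor_all_adjoint
        by (subst tensor_all_mult[where \<delta> = \<delta>]) (simp_all add: U_carrier T_carrier)
      also have "\<dots> = tensor_all S (\<lambda>s. U s (W s) * T s (X s A) (Z s A) * mat_adjoint (U s (W s)))"
        using U_carrier T_carrier by (intro tensor_all_mult[where \<delta> = \<delta>]) (auto intro!: mult_carrier_mat)
      also have "\<dots> = tensor_all S (\<lambda>s.
          \<chi> (\<Sum>t\<in>J s. v s (W s) t * X s A t - Z s A t * u s (W s) t) \<cdot>\<^sub>m T s (X s A) (Z s A))"
        by (rule tensor_all_cong) (simp add: U_def pauli_unitary(2)[OF T])
      also have "\<dots> = \<chi> (mat_inner A (lc_output S K V L W)) \<cdot>\<^sub>m G A"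
        unfolding tensor_all_smult prod_eq G_def using syndrome[of W A, OF W A] by simp
      finally show ?thesis .
    qed
  qed
  then show ?thesis by blast
qed

end

section \<open>Rank factorisation and placement of the auxiliary qudits\<close>

text \<open>A maximal independent set \<open>B\<close> of columns spans all columns, and
  \<open>\<gamma>\<close> collects the coefficients. The elements of \<open>B\<close> later serve as
  names of the auxiliary qudits.\<close>

lemma rank_decomposition:
  fixes Q :: "'a::field mat"
  assumes Q: "Q \<in> carrier_mat K k"
  shows "\<exists>B \<gamma>. finite B \<and> card B = vec_space.rank K Q \<and>
    (\<forall>i<K. \<forall>j<k. Q $$ (i, j) = (\<Sum>b\<in>B. b $ i * \<gamma> j b))"
proof -
  interpret vec_space "TYPE('a)" K .
  obtain B where fin: "finite B" and max: "maximal B (\<lambda>T. T \<subseteq> set (cols Q) \<and> lin_indpt T)"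
    using maximal_exists_superset[of "set (cols Q)" "\<lambda>T. T \<subseteq> set (cols Q) \<and> lin_indpt T" "{}"]
      finite_lin_indpt2[of "{}"] by auto
  have B: "B \<subseteq> set (cols Q)" "lin_indpt B" using max by (auto simp: maximal_def)
  have cols: "set (cols Q) \<subseteq> carrier_vec K" using cols_dim Q by blast
  then have Bc: "B \<subseteq> carrier_vec K" using B by auto
  have "x \<in> span B" if x: "x \<in> set (cols Q)" for x
  proof (rule ccontr)
    assume ns: "x \<notin> span B"
    then have "x \<notin> B" using in_own_span[OF Bc] by auto
    moreover have "lin_indpt (insert x B)"
      using lin_dep_iff_in_span[of B x] Bc B x cols ns \<open>x \<notin> B\<close> by auto
    ultimately show False using max x B by (auto simp: maximal_def)
  qed
  then have "\<forall>j. \<exists>a. j < k \<longrightarrow> lincomb a B = col Q j"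
    using finite_in_span[OF fin Bc] Q by (metis cols_length cols_nth nth_mem carrier_matD(2))
  then obtain \<gamma> where \<gamma>: "\<And>j. j < k \<Longrightarrow> lincomb (\<gamma> j) B = col Q j" by metis
  have "Q $$ (i, j) = (\<Sum>b\<in>B. b $ i * \<gamma> j b)" if ij: "i < K" "j < k" for i j
  proof -
    have "Q $$ (i, j) = lincomb (\<gamma> j) B $ i" using \<gamma> ij Q by simp
    also have "\<dots> = (\<Sum>b\<in>B. \<gamma> j b * b $ i)" by (rule lincomb_index[OF ij(1) Bc])
    finally show ?thesis by (simp add: mult.commute)
  qed
  moreover have "card B = rank Q" using rank_card_indpt[OF Q max] ..
  ultimately show ?thesis using fin by blast
qed

text \<open>Greedy filling: the last server takes as many items as it has room for, and the
  remainder is left to the others.\<close>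

lemma ex_distribution:
  fixes S :: nat
  assumes "finite T" "card T \<le> (\<Sum>s<S. e s)"
  shows "\<exists>f. (\<forall>t\<in>T. f t < S) \<and> (\<forall>s<S. card {t \<in> T. f t = s} \<le> (e s :: nat))"
  using assms
proof (induction S arbitrary: T)
  case (Suc S)
  obtain R where R: "R \<subseteq> T" "card R = min (card T) (e S)"
    using obtain_subset_with_card_n[of "min (card T) (e S)" T] by auto
  have finR: "finite R" using R Suc.prems(1) by (rule_tac finite_subset)
  have "card (T - R) = card T - card R" using R finR by (simp add: card_Diff_subset)
  also have "\<dots> \<le> (\<Sum>s<S. e s)" using R Suc.prems(2) by auto
  finally obtain f where f: "\<And>t. t \<in> T - R \<Longrightarrow> f t < S" "\<And>s. s < S \<Longrightarrow> card {t \<in> T - R. f t = s} \<le> e s"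
    using Suc.IH[of "T - R"] Suc.prems(1) by auto
  define g where "g t = (if t \<in> R then S else f t)" for t
  have "g t < Suc S" if "t \<in> T" for t using that f(1)[of t] by (auto simp: g_def)
  moreover have "card {t \<in> T. g t = s} \<le> e s" if "s < Suc S" for s
  proof (cases "s = S")
    case True
    then have "{t \<in> T. g t = s} = R" using R f(1) by (auto simp: g_def)
    then show ?thesis using R True by simp
  next
    case False
    then have "{t \<in> T. g t = s} = {t \<in> T - R. f t = s}" by (auto simp: g_def)
    then show ?thesis using f(2)[of s] that False by simp
  qed
  ultimately show ?case by blast
qed simp

text \<open>Moves the sum over qudits \<open>k\<close> inside, so that a commutator of stabilisers
  becomes a bilinear form in their labels whose coefficients are the inner sums.\<close>

lemma sum_bilinear_contract:
  fixes a c :: "'r \<Rightarrow> 'k \<Rightarrow> 'a::comm_semiring_0"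
  shows "(\<Sum>k\<in>I. (\<Sum>r\<in>R. a r k * x r) * (\<Sum>r'\<in>R. c r' k * y r')) =
    (\<Sum>r\<in>R. \<Sum>r'\<in>R. x r * y r' * (\<Sum>k\<in>I. c r' k * a r k))"
proof -
  have "(\<Sum>k\<in>I. (\<Sum>r\<in>R. a r k * x r) * (\<Sum>r'\<in>R. c r' k * y r')) =
      (\<Sum>k\<in>I. \<Sum>r\<in>R. \<Sum>r'\<in>R. x r * y r' * (c r' k * a r k))"
    unfolding sum_product by (intro sum.cong refl) (simp add: mult_ac)
  also have "\<dots> = (\<Sum>r\<in>R. \<Sum>k\<in>I. \<Sum>r'\<in>R. x r * y r' * (c r' k * a r k))"
    by (rule sum.swap)
  also have "\<dots> = (\<Sum>r\<in>R. \<Sum>r'\<in>R. \<Sum>k\<in>I. x r * y r' * (c r' k * a r k))"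
    by (rule sum.cong[OF refl]) (rule sum.swap)
  finally show ?thesis by (simp add: sum_distrib_left)
qed

lemma sum_linear_contract:
  fixes a :: "'r \<Rightarrow> 'k \<Rightarrow> 'a::comm_semiring_0"
  shows "(\<Sum>k\<in>I. y k * (\<Sum>r\<in>R. a r k * x r)) = (\<Sum>r\<in>R. x r * (\<Sum>k\<in>I. a r k * y k))"
  unfolding sum_distrib_left by (subst sum.swap) (simp add: mult_ac)

lemma sum_lessThan_add_nat:
  fixes n k :: nat
  shows "(\<Sum>j<n + k. g j) = (\<Sum>i<n. g i) + (\<Sum>i<k. g (n + i) :: 'a::comm_monoid_add)"
  by (induction k) (simp_all add: add.assoc)

context additive_character
begin

text \<open>The instances are paired up: the \<open>i\<close>-th and the \<open>(n + i)\<close>-th instance share the data qudits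
  \<open>Inl (i, k)\<close>, the first being seen by \<open>X\<close>-type and the second by \<open>Z\<close>-type stabilisers. The
  commutator of these stabilisers is governed by \<open>\<Sum>s. V s * P s * (V s)\<^sup>T\<close>. The auxiliary
  qudits \<open>Inr (i, b)\<close>, which carry no data, are placed at the server \<open>f (i, b)\<close> and cancel it, one
  for each term of a rank decomposition.\<close>

lemma ex_successful_scheme_aux:
  fixes V P R :: "nat \<Rightarrow> 'a mat" and B :: "'a vec set"
  assumes V: "\<And>s. s < S \<Longrightarrow> V s \<in> carrier_mat K (m s)"
    and P: "\<And>s. s < S \<Longrightarrow> P s \<in> carrier_mat (m s) (m s)"
    and R: "\<And>s. s < S \<Longrightarrow> R s \<in> carrier_mat (m s) (m s)"
    and PR: "\<And>s. s < S \<Longrightarrow> P s * R s = 1\<^sub>m (m s)"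
    and B: "finite B"
    and Q: "\<And>i j. i < K \<Longrightarrow> j < K \<Longrightarrow>
      mat_sum K K (\<lambda>s. V s * P s * transpose_mat (V s)) {..<S} $$ (i, j) = (\<Sum>b\<in>B. b $ i * \<gamma> j b)"
    and f: "\<And>t. t \<in> {..<n} \<times> B \<Longrightarrow> f t < S"
    and \<delta>: "\<And>s. s < S \<Longrightarrow> CARD('a) ^ (n * m s + card {t \<in> {..<n} \<times> B. f t = s}) \<le> \<delta> s"
  shows "\<exists>\<rho> U N M dec. successful_scheme S K m V (2 * n) \<delta> \<rho> U N M dec"
proof -
  let ?L = "2 * n"
  define F where "F s = {t \<in> {..<n} \<times> B. f t = s}" for s
  define J where "J s = ({..<n} \<times> {..<m s}) <+> F s" for s
  \<comment> \<open>\<open>P s\<close> enters only here and not in \<open>Z\<close>. The minus sign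
    lets the auxiliary qudits cancel the data qudits. The default 0 for \<open>i\<close> outside the
    range is needed because additivity is demanded at every \<open>t\<close>, even outside
    \<open>J s\<close>, where matrix entries would be out of bounds.\<close>
  define X where "X s A t = (case t of
      Inl (i, k) \<Rightarrow> if i < n then \<Sum>r<K. (V s * P s) $$ (r, k) * A $$ (r, i) else 0
    | Inr (i, b) \<Rightarrow> if i < n then - (\<Sum>r<K. b $ r * A $$ (r, i)) else 0)"
    for s :: nat and A :: "'a mat" and t :: "(nat \<times> nat) + (nat \<times> 'a vec)"
  define Z where "Z s A t = (case t of
      Inl (i, k) \<Rightarrow> if i < n then \<Sum>r<K. V s $$ (r, k) * A $$ (r, n + i) else 0
    | Inr (i, b) \<Rightarrow> if i < n then \<Sum>r<K. \<gamma> r b * A $$ (r, n + i) else 0)"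
    for s :: nat and A :: "'a mat" and t :: "(nat \<times> nat) + (nat \<times> 'a vec)"
  \<comment> \<open>Encoding with the inverse \<open>R s\<close> cancels the factor
    \<open>P s\<close> seen by the X-type stabilisers. In \<open>u\<close> the sign compensates that
    of the symplectic product.\<close>
  define v where "v s w t = (case t of Inl (i, k) \<Rightarrow> (R s * w) $$ (k, i) | Inr _ \<Rightarrow> 0)"
    for s :: nat and w :: "'a mat" and t :: "(nat \<times> nat) + (nat \<times> 'a vec)"
  define u where "u s w t = (case t of Inl (i, k) \<Rightarrow> - (w $$ (k, n + i)) | Inr _ \<Rightarrow> 0)"
    for s :: nat and w :: "'a mat" and t :: "(nat \<times> nat) + (nat \<times> 'a vec)"
  have finF: "finite (F s)" for s using B by (simp add: F_def)
  have sum_J: "(\<Sum>t\<in>J s. g t) = (\<Sum>i<n. \<Sum>k<m s. g (Inl (i, k))) + (\<Sum>t\<in>F s. g (Inr t))"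
    for s and g :: "_ \<Rightarrow> 'a"
    unfolding J_def by (simp add: sum.Plus finF sum.cartesian_product)
  have Q': "(\<Sum>s<S. \<Sum>k<m s. (V s * P s) $$ (r', k) * V s $$ (r, k)) = (\<Sum>b\<in>B. b $ r' * \<gamma> r b)"
    if "r < K" "r' < K" for r r'
  proof -
    have "(\<Sum>s<S. \<Sum>k<m s. (V s * P s) $$ (r', k) * V s $$ (r, k)) =
        (\<Sum>s<S. (V s * P s * transpose_mat (V s)) $$ (r', r))"
    proof (rule sum.cong)
      fix s assume "s \<in> {..<S}"
      then have s: "V s \<in> carrier_mat K (m s)" "P s \<in> carrier_mat (m s) (m s)" using V P by auto
      show "(\<Sum>k<m s. (V s * P s) $$ (r', k) * V s $$ (r, k)) = (V s * P s * transpose_mat (V s)) $$ (r', r)"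
        using s that by (subst index_mult_mat_sum[of "V s * P s" K "m s" _ K]) (auto intro!: sum.cong)
    qed simp
    then show ?thesis using Q[OF that(2,1)] that by simp
  qed
  show ?thesis
  proof (rule successful_scheme_of_code)
    show "finite (J s)" for s by (simp add: J_def finF)
    show "CARD('a) ^ card (J s) \<le> \<delta> s" if "s < S" for s
      using \<delta>[OF that] by (simp add: J_def card_Plus finF F_def[symmetric] card_cartesian_product)
    show "X s (A + A') t = X s A t + X s A' t" "Z s (A + A') t = Z s A t + Z s A' t"
      if "A \<in> carrier_mat K ?L" "A' \<in> carrier_mat K ?L" for s A A' t
      using that by (auto simp: X_def Z_def distrib_left sum.distrib split: sum.splits)
    show "(\<Sum>s<S. \<Sum>t\<in>J s. Z s A t * X s A' t) = 0" for A A'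
    proof -
      \<comment> \<open>The contribution of the \<open>i\<close>-th pair of instances to the
        commutator; data and auxiliary qudits produce it with opposite signs.\<close>
      define q where "q i = (\<Sum>r<K. \<Sum>r'<K. A $$ (r, n + i) * A' $$ (r', i) * (\<Sum>b\<in>B. b $ r' * \<gamma> r b))" for i
      let ?D = "\<lambda>s i k. (\<Sum>r<K. V s $$ (r, k) * A $$ (r, n + i)) * (\<Sum>r'<K. (V s * P s) $$ (r', k) * A' $$ (r', i))"
      let ?E = "\<lambda>(i, b). (\<Sum>r<K. \<gamma> r b * A $$ (r, n + i)) * (\<Sum>r'<K. b $ r' * A' $$ (r', i))"
      have "(\<Sum>t\<in>J s. Z s A t * X s A' t) = (\<Sum>i<n. \<Sum>k<m s. ?D s i k) - (\<Sum>t\<in>F s. ?E t)" for s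
        unfolding sum_J diff_conv_add_uminus sum_negf[symmetric]
        by (intro arg_cong2[where f = plus] sum.cong refl) (auto simp: X_def Z_def F_def)
      then have "(\<Sum>s<S. \<Sum>t\<in>J s. Z s A t * X s A' t) =
          (\<Sum>s<S. \<Sum>i<n. \<Sum>k<m s. ?D s i k) - (\<Sum>s<S. \<Sum>t\<in>F s. ?E t)"
        by (simp add: sum_subtractf)
      also have "(\<Sum>s<S. \<Sum>i<n. \<Sum>k<m s. ?D s i k) = (\<Sum>i<n. \<Sum>s<S. \<Sum>k<m s. ?D s i k)"
        by (rule sum.swap)
      also have "\<dots> = (\<Sum>i<n. q i)"
      proof (rule sum.cong)
        fix i
        have "(\<Sum>s<S. \<Sum>k<m s. ?D s i k) = (\<Sum>(s, k)\<in>(SIGMA s:{..<S}. {..<m s}). ?D s i k)"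
          by (simp add: sum.Sigma)
        also have "\<dots> = (\<Sum>p\<in>(SIGMA s:{..<S}. {..<m s}). (\<Sum>r<K. V (fst p) $$ (r, snd p) * A $$ (r, n + i)) *
            (\<Sum>r'<K. (V (fst p) * P (fst p)) $$ (r', snd p) * A' $$ (r', i)))"
          by (simp add: split_def)
        also have "\<dots> = (\<Sum>r<K. \<Sum>r'<K. A $$ (r, n + i) * A' $$ (r', i) *
            (\<Sum>p\<in>(SIGMA s:{..<S}. {..<m s}). (V (fst p) * P (fst p)) $$ (r', snd p) * V (fst p) $$ (r, snd p)))"
          by (rule sum_bilinear_contract)
        also have "\<dots> = q i"
          unfolding q_def
        proof (intro sum.cong refl arg_cong2[where f = times])
          fix r r' assume "r \<in> {..<K}" "r' \<in> {..<K}"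
          then show "(\<Sum>p\<in>(SIGMA s:{..<S}. {..<m s}). (V (fst p) * P (fst p)) $$ (r', snd p) * V (fst p) $$ (r, snd p)) =
              (\<Sum>b\<in>B. b $ r' * \<gamma> r b)"
            using Q'[of r r'] by (simp add: sum.Sigma split_def)
        qed
        finally show "(\<Sum>s<S. \<Sum>k<m s. ?D s i k) = q i" .
      qed simp
      \<comment> \<open>The sets \<open>F s\<close> are the fibres of \<open>f\<close>, so each
        auxiliary qudit is counted at exactly one server.\<close>
      also have "(\<Sum>s<S. \<Sum>t\<in>F s. ?E t) = (\<Sum>t\<in>{..<n} \<times> B. ?E t)"
        unfolding F_def by (rule sum.group) (use f B in auto)
      also have "\<dots> = (\<Sum>i<n. \<Sum>b\<in>B. ?E (i, b))" by (simp add: sum.cartesian_product)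
      also have "\<dots> = (\<Sum>i<n. q i)"
        unfolding q_def prod.case by (intro sum.cong refl sum_bilinear_contract)
      finally show ?thesis by simp
    qed
    show "(\<Sum>s<S. \<Sum>t\<in>J s. v s (W s) t * X s A t - Z s A t * u s (W s) t) = mat_inner A (lc_output S K V ?L W)"
      if W: "\<And>s. s < S \<Longrightarrow> W s \<in> carrier_mat (m s) ?L" and A: "A \<in> carrier_mat K ?L" for W A
    proof -
      have server: "(\<Sum>t\<in>J s. v s (W s) t * X s A t - Z s A t * u s (W s) t) =
          (\<Sum>r<K. \<Sum>j<?L. A $$ (r, j) * (V s * W s) $$ (r, j))" if s: "s < S" for s
      proof -
        note c = V[OF s] P[OF s] R[OF s] W[OF s]
        have VPRW: "V s * P s * (R s * W s) = V s * W s"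
        proof -
          have "V s * P s * (R s * W s) = V s * (P s * (R s * W s))"
            using c by (intro assoc_mult_mat[of _ K "m s" _ "m s" _ ?L]) auto
          also have "P s * (R s * W s) = P s * R s * W s"
            using c by (intro assoc_mult_mat[symmetric, of _ "m s" "m s" _ "m s" _ ?L]) auto
          finally show ?thesis using PR[OF s] c by simp
        qed
        have "(\<Sum>t\<in>J s. v s (W s) t * X s A t - Z s A t * u s (W s) t) =
          (\<Sum>i<n. \<Sum>k<m s. (R s * W s) $$ (k, i) * (\<Sum>r<K. (V s * P s) $$ (r, k) * A $$ (r, i)) +
            W s $$ (k, n + i) * (\<Sum>r<K. V s $$ (r, k) * A $$ (r, n + i)))"
          unfolding sum_J by (simp add: v_def u_def X_def Z_def mult.commute split_def)
        also have "\<dots> = (\<Sum>i<n. (\<Sum>k<m s. (R s * W s) $$ (k, i) * (\<Sum>r<K. (V s * P s) $$ (r, k) * A $$ (r, i))) +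
            (\<Sum>k<m s. W s $$ (k, n + i) * (\<Sum>r<K. V s $$ (r, k) * A $$ (r, n + i))))"
          by (simp only: sum.distrib)
        also have "\<dots> = (\<Sum>i<n. (\<Sum>r<K. A $$ (r, i) * (V s * W s) $$ (r, i)) +
            (\<Sum>r<K. A $$ (r, n + i) * (V s * W s) $$ (r, n + i)))"
        proof (rule sum.cong[OF refl], rule arg_cong2[where f = plus])
          fix i assume i: "i \<in> {..<n}"
          have 1: "(\<Sum>k<m s. (V s * P s) $$ (r, k) * (R s * W s) $$ (k, i)) = (V s * W s) $$ (r, i)" if "r < K" for r
            unfolding VPRW[symmetric] using c that i by (intro index_mult_mat_sum[symmetric, of _ K _ _ ?L]) auto
          show "(\<Sum>k<m s. (R s * W s) $$ (k, i) * (\<Sum>r<K. (V s * P s) $$ (r, k) * A $$ (r, i))) =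
              (\<Sum>r<K. A $$ (r, i) * (V s * W s) $$ (r, i))"
            using 1 by (subst sum_linear_contract) auto
          have 2: "(\<Sum>k<m s. V s $$ (r, k) * W s $$ (k, n + i)) = (V s * W s) $$ (r, n + i)" if "r < K" for r
            using c that i by (intro index_mult_mat_sum[symmetric, of _ K _ _ ?L]) auto
          show "(\<Sum>k<m s. W s $$ (k, n + i) * (\<Sum>r<K. V s $$ (r, k) * A $$ (r, n + i))) =
              (\<Sum>r<K. A $$ (r, n + i) * (V s * W s) $$ (r, n + i))"
            using 2 by (subst sum_linear_contract) auto
        qed
        also have "\<dots> = (\<Sum>j<?L. \<Sum>r<K. A $$ (r, j) * (V s * W s) $$ (r, j))"
          unfolding mult_2 sum_lessThan_add_nat by (simp add: sum.distrib)
        also have "\<dots> = (\<Sum>r<K. \<Sum>j<?L. A $$ (r, j) * (V s * W s) $$ (r, j))" by (rule sum.swap)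
        finally show ?thesis .
      qed
      have "(\<Sum>s<S. \<Sum>t\<in>J s. v s (W s) t * X s A t - Z s A t * u s (W s) t) =
          (\<Sum>s<S. \<Sum>r<K. \<Sum>j<?L. A $$ (r, j) * (V s * W s) $$ (r, j))"
        using server by simp
      also have "\<dots> = (\<Sum>r<K. \<Sum>s<S. \<Sum>j<?L. A $$ (r, j) * (V s * W s) $$ (r, j))" by (rule sum.swap)
      also have "\<dots> = (\<Sum>r<K. \<Sum>j<?L. \<Sum>s<S. A $$ (r, j) * (V s * W s) $$ (r, j))"
        by (rule sum.cong[OF refl]) (rule sum.swap)
      also have "\<dots> = mat_inner A (lc_output S K V ?L W)"
        using A by (simp add: mat_inner_def lc_output_def sum_distrib_left)
      finally show ?thesis .
    qed
  qed
qed

end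

lemma det_nonzero_inverse:
  fixes A :: "'a::field mat"
  assumes "A \<in> carrier_mat n n" "det A \<noteq> 0"
  shows "\<exists>B\<in>carrier_mat n n. A * B = 1\<^sub>m n"
  using det_non_zero_imp_unit[OF assms, of "()"] by (auto simp: Units_def ring_mat_simps)

text \<open>A minimiser \<open>P\<close> gives \<open>c_min S K m V\<close> rank-one terms, hence
  \<open>n\<close> times as many auxiliary qudits; \<open>e s\<close> is the room that server
  \<open>s\<close> has left beyond its data qudits.\<close>

lemma ex_successful_scheme:
  fixes V :: "nat \<Rightarrow> 'a::{finite,field} mat"
  assumes V: "\<And>s. s < S \<Longrightarrow> V s \<in> carrier_mat K (m s)"
    and \<delta>: "\<And>s. s < S \<Longrightarrow> CARD('a) ^ (n * m s + e s) \<le> \<delta> s"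
    and e: "n * c_min S K m V \<le> (\<Sum>s<S. e s)"
  shows "\<exists>\<rho> U N M dec. successful_scheme S K m V (2 * n) \<delta> \<rho> U N M dec"
proof -
  obtain \<chi> :: "'a \<Rightarrow> complex" where "additive_character \<chi>"
    using nontrivial_additive_character unfolding additive_character_def by metis
  then interpret additive_character \<chi> .
  obtain P where P: "\<And>s. s < S \<Longrightarrow> P s \<in> carrier_mat (m s) (m s)" "\<And>s. s < S \<Longrightarrow> det (P s) \<noteq> 0"
    and rank: "c_min S K m V = vec_space.rank K (mat_sum K K (\<lambda>s. V s * P s * transpose_mat (V s)) {..<S})"
    using c_min_in[of S K m V] unfolding c_ranks_def by auto
  have "\<forall>s. \<exists>R. s < S \<longrightarrow> R \<in> carrier_mat (m s) (m s) \<and> P s * R = 1\<^sub>m (m s)"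
    using det_nonzero_inverse P by blast
  then obtain R where R: "\<And>s. s < S \<Longrightarrow> R s \<in> carrier_mat (m s) (m s)" "\<And>s. s < S \<Longrightarrow> P s * R s = 1\<^sub>m (m s)"
    by metis
  obtain B \<gamma> where B: "finite B" "card B = c_min S K m V"
    and Q: "\<And>i j. i < K \<Longrightarrow> j < K \<Longrightarrow>
      mat_sum K K (\<lambda>s. V s * P s * transpose_mat (V s)) {..<S} $$ (i, j) = (\<Sum>b\<in>B. b $ i * \<gamma> j b)"
    using rank_decomposition[OF mat_sum_carrier[of K K "\<lambda>s. V s * P s * transpose_mat (V s)" "{..<S}"]]
    unfolding rank by blast
  have "card ({..<n} \<times> B) \<le> (\<Sum>s<S. e s)" using e B by (simp add: card_cartesian_product)
  then obtain f where f: "\<And>t. t \<in> {..<n} \<times> B \<Longrightarrow> f t < S"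
    and card_f: "\<And>s. s < S \<Longrightarrow> card {t \<in> {..<n} \<times> B. f t = s} \<le> e s"
    using ex_distribution[of "{..<n} \<times> B" e S] B by auto
  show ?thesis
  proof (rule ex_successful_scheme_aux[OF V P(1) R B(1) Q f])
    fix s assume s: "s < S"
    have "CARD('a) ^ (n * m s + card {t \<in> {..<n} \<times> B. f t = s}) \<le> CARD('a) ^ (n * m s + e s)"
      using card_f[OF s] by (intro power_increasing) auto
    also have "\<dots> \<le> \<delta> s" by (rule \<delta>[OF s])
    finally show "CARD('a) ^ (n * m s + card {t \<in> {..<n} \<times> B. f t = s}) \<le> \<delta> s" .
  qed
qed

subsection \<open>Subsystem dimensions\<close>

text \<open>Each \<open>\<delta> s\<close> divides a power of \<open>p\<close> and so is itself some
  p^j. Its \<open>2 * r\<close>-th power is then the \<open>2 * j\<close>-th power of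
  \<open>p ^ r\<close>, without any rounding.\<close>

lemma dividing_powers_in_prime_power:
  fixes \<delta> :: "nat \<Rightarrow> nat"
  assumes p: "prime p" and r: "0 < r"
    and low: "\<And>s. s < S \<Longrightarrow> (p ^ r) ^ a s \<le> \<delta> s ^ 2"
    and prod: "(p ^ r) ^ N = (\<Prod>s<S. \<delta> s ^ 2)"
  shows "\<exists>k. (\<forall>s<S. (p ^ r) ^ k s = \<delta> s ^ (2 * r) \<and> r * a s \<le> k s) \<and> (\<Sum>s<S. k s) = r * N"
proof -
  have p1: "1 < p" using p prime_gt_1_nat by blast
  have "\<forall>s. \<exists>k. s < S \<longrightarrow> \<delta> s = p ^ k"
  proof (intro allI)
    fix s
    show "\<exists>k. s < S \<longrightarrow> \<delta> s = p ^ k"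
    proof (cases "s < S")
      case True
      have "\<delta> s dvd \<delta> s ^ 2" by (simp add: power2_eq_square)
      also have "\<delta> s ^ 2 dvd (\<Prod>s<S. \<delta> s ^ 2)" using True by (intro dvd_prodI) auto
      also have "\<dots> = p ^ (r * N)" by (simp add: prod[symmetric] power_mult)
      finally show ?thesis using divides_primepow_nat[OF p] by blast
    qed simp
  qed
  then obtain k where k: "\<And>s. s < S \<Longrightarrow> \<delta> s = p ^ k s" by metis
  have "p ^ (r * N) = p ^ (\<Sum>s<S. k s * 2)"
    using prod k by (simp add: power_mult[symmetric] power_sum)
  then have sum: "r * N = (\<Sum>s<S. k s * 2)" using p1 power_inject_exp by blast
  show ?thesis
  proof (intro exI[of _ "\<lambda>s. 2 * k s"] conjI allI impI)
    fix s assume s: "s < S"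
    show "(p ^ r) ^ (2 * k s) = \<delta> s ^ (2 * r)" using k[OF s] by (simp add: power_mult[symmetric] mult_ac)
    have "p ^ (r * a s) \<le> p ^ (2 * k s)"
      using low[OF s] k[OF s] by (simp add: power_mult[symmetric] mult_ac)
    then show "r * a s \<le> 2 * k s" using p1 power_le_imp_le_exp by blast
  next
    show "(\<Sum>s<S. 2 * k s) = r * N" using sum by (simp add: mult.commute)
  qed
qed

text \<open>Passing to \<open>q\<close>-th powers leaves room to round all \<open>\<delta> s\<close> down to powers of \<open>d\<close>. If the
  bound on the product is strict, rounding costs at most a factor \<open>d\<close> per server, which is negligible
  for large \<open>q\<close>; if it is an equality, all \<open>\<delta> s\<close> are powers of the characteristic and nothing is
  lost.\<close>

lemma ex_round_down_powers:
  fixes \<delta> :: "nat \<Rightarrow> nat"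
  assumes p: "prime p" and r: "0 < r" and d: "d = p ^ r"
    and pos: "\<And>s. s < S \<Longrightarrow> 0 < \<delta> s"
    and low: "\<And>s. s < S \<Longrightarrow> d ^ a s \<le> \<delta> s ^ 2"
    and prod: "d ^ N \<le> (\<Prod>s<S. \<delta> s ^ 2)"
  shows "\<exists>q k. 0 < q \<and> (\<forall>s<S. d ^ k s \<le> \<delta> s ^ (2 * q) \<and> q * a s \<le> k s) \<and> q * N \<le> (\<Sum>s<S. k s)"
proof (cases "d ^ N = (\<Prod>s<S. \<delta> s ^ 2)")
  case True
  \<comment> \<open>The multiplier \<open>q\<close> is \<open>r\<close> here.\<close>
  then show ?thesis
    using dividing_powers_in_prime_power[OF p r, of S a \<delta> N] low r unfolding d
    by (metis order_refl)
next
  case False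
  with prod have strict: "d ^ N < (\<Prod>s<S. \<delta> s ^ 2)" by simp
  have d1: "1 < real d" using p r prime_gt_1_nat[OF p] by (simp add: d)
  define \<beta> where "\<beta> s = log (real d) (real (\<delta> s ^ 2))" for s
  have powr_\<beta>: "real d powr \<beta> s = real (\<delta> s ^ 2)" if "s < S" for s
    unfolding \<beta>_def using d1 pos[OF that] by (intro powr_log_cancel) auto
  have \<beta>_ge: "real (a s) \<le> \<beta> s" if "s < S" for s
  proof -
    have "real d powr real (a s) \<le> real d powr \<beta> s"
      unfolding powr_\<beta>[OF that] using d1 low[OF that] by (simp add: powr_realpow flip: of_nat_power)
    then show ?thesis using d1 by simp
  qed
  have "real d powr real N < real d powr (\<Sum>s<S. \<beta> s)"
  proof -
    have "real d powr real N = real (d ^ N)" using d1 by (simp add: powr_realpow)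
    also have "\<dots> < real (\<Prod>s<S. \<delta> s ^ 2)" using strict by (rule of_nat_less_iff[THEN iffD2])
    also have "\<dots> = (\<Prod>s<S. real d powr \<beta> s)" using powr_\<beta> by simp
    also have "\<dots> = real d powr (\<Sum>s<S. \<beta> s)" using d1 by (simp add: powr_sum)
    finally show ?thesis .
  qed
  then have gap: "0 < (\<Sum>s<S. \<beta> s) - real N" using d1 by simp
  obtain q0 :: nat where q0: "real S < real q0 * ((\<Sum>s<S. \<beta> s) - real N)"
    using reals_Archimedean3[OF gap] by blast
  define q where "q = Suc q0"
  have q: "real S \<le> real q * ((\<Sum>s<S. \<beta> s) - real N)"
    using q0 gap by (simp add: q_def distrib_right)
  define k where "k s = nat \<lfloor>real q * \<beta> s\<rfloor>" for s
  have k: "real (k s) \<le> real q * \<beta> s" "real q * \<beta> s - 1 \<le> real (k s)" if "s < S" for s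
    using \<beta>_ge[OF that] by (auto simp: k_def)
  show ?thesis
  proof (intro exI conjI allI impI)
    show "0 < q" by (simp add: q_def)
    fix s assume s: "s < S"
    have "real (d ^ k s) = real d powr real (k s)" using d1 by (simp add: powr_realpow)
    also have "\<dots> \<le> real d powr (real q * \<beta> s)" using d1 k(1)[OF s] by simp
    also have "\<dots> = (real d powr \<beta> s) powr real q" by (simp add: powr_powr mult.commute)
    also have "\<dots> = real (\<delta> s ^ (2 * q))"
      unfolding powr_\<beta>[OF s] using pos[OF s] by (simp add: powr_realpow power_mult)
    finally show "d ^ k s \<le> \<delta> s ^ (2 * q)" by (simp only: of_nat_le_iff)
    \<comment> \<open>Taking the floor preserves this lower bound because \<open>q * a s\<close> is
      an integer.\<close>
    have "int (q * a s) \<le> \<lfloor>real q * \<beta> s\<rfloor>"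
      using \<beta>_ge[OF s] by (simp add: le_floor_iff mult_left_mono)
    then show "q * a s \<le> k s" unfolding k_def by linarith
  next
    have "real (q * N) \<le> real q * (\<Sum>s<S. \<beta> s) - real S" using q by (simp add: algebra_simps)
    also have "\<dots> = (\<Sum>s<S. real q * \<beta> s - 1)" by (simp add: sum_subtractf sum_distrib_left)
    also have "\<dots> \<le> (\<Sum>s<S. real (k s))" using k(2) by (intro sum_mono) auto
    finally show "q * N \<le> (\<Sum>s<S. k s)" by (simp only: of_nat_sum[symmetric] of_nat_le_iff)
  qed
qed

section \<open>Achievability of the region and of the rate\<close>

lemma power_le_of_log:
  assumes "1 < d" "0 < x" "real k \<le> log (real d) (real x)"
  shows "d ^ k \<le> x"
proof -
  have "real (d ^ k) = real d powr real k" using assms by (simp add: powr_realpow)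
  also have "\<dots> \<le> real x" using assms by (simp add: le_log_iff)
  finally show ?thesis by simp
qed

text \<open>Replacing the dimensions by their \<open>2 * q\<close>-th powers and \<open>L\<close> by
  \<open>2 * q * L\<close> leaves the normalised cost unchanged, so the tuple is met exactly. Of the
  \<open>k s\<close> whole qudits that fit into server \<open>s\<close>, \<open>n * m s\<close>
  carry data and the other \<open>e s\<close> are free for auxiliary use.\<close>

lemma achievable_tuple_if_D_LC:
  fixes V :: "nat \<Rightarrow> 'a::{finite,field} mat"
  assumes V: "\<And>s. s < S \<Longrightarrow> V s \<in> carrier_mat K (m s)"
    and \<Delta>: "\<Delta> \<in> D_LC S K m V" and tuple: "download_cost_tuple CARD('a) S \<Delta>"
  shows "achievable_tuple S K m V \<Delta>"
proof -
  let ?d = "CARD('a)" and ?c = "c_min S K m V"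
  obtain L \<delta> where L: "1 \<le> L" and pos: "\<And>s. s < S \<Longrightarrow> 0 < \<delta> s"
    and \<delta>: "\<And>s. s < S \<Longrightarrow> \<Delta> s = log (real ?d) (real (\<delta> s)) / real L"
    using tuple unfolding download_cost_tuple_def by auto
  have log_\<delta>: "log (real ?d) (real (\<delta> s ^ j)) = real (j * L) * \<Delta> s" if "s < S" for s j
    using \<delta>[OF that] pos[OF that] L CARD_field_gt_1[where 'a = 'a] by (simp add: log_nat_power)
  obtain r where r: "0 < r" "?d = CHAR('a) ^ r"
    using CARD_finite_field_eq_CHAR_power by blast
  have m: "real (m s) \<le> 2 * \<Delta> s" if "s < S" for s using \<Delta> that by (simp add: D_LC_def)
  have sum: "real ((\<Sum>s<S. m s) + ?c) \<le> (\<Sum>s<S. 2 * \<Delta> s)" using \<Delta> by (simp add: D_LC_def)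
  have low: "?d ^ (L * m s) \<le> \<delta> s ^ 2" if s: "s < S" for s
  proof (rule power_le_of_log)
    have "real (L * m s) = real L * real (m s)" by simp
    also have "\<dots> \<le> real L * (2 * \<Delta> s)" using m[OF s] by (intro mult_left_mono) auto
    also have "\<dots> = log (real ?d) (real (\<delta> s ^ 2))" unfolding log_\<delta>[OF s] by simp
    finally show "real (L * m s) \<le> log (real ?d) (real (\<delta> s ^ 2))" .
  qed (use CARD_field_gt_1 pos s in auto)
  have prod: "?d ^ (L * ((\<Sum>s<S. m s) + ?c)) \<le> (\<Prod>s<S. \<delta> s ^ 2)"
  proof (rule power_le_of_log)
    have "real (L * ((\<Sum>s<S. m s) + ?c)) = real L * real ((\<Sum>s<S. m s) + ?c)" by simp
    also have "\<dots> \<le> real L * (\<Sum>s<S. 2 * \<Delta> s)" using sum by (intro mult_left_mono) auto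
    also have "\<dots> = (\<Sum>s<S. log (real ?d) (real (\<delta> s ^ 2)))"
      unfolding sum_distrib_left by (intro sum.cong) (auto simp only: log_\<delta> lessThan_iff of_nat_mult)
    also have "\<dots> = log (real ?d) (\<Prod>s<S. real (\<delta> s ^ 2))"
      unfolding log_def sum_divide_distrib[symmetric] using pos by (subst ln_prod) auto
    finally show "real (L * ((\<Sum>s<S. m s) + ?c)) \<le> log (real ?d) (real (\<Prod>s<S. \<delta> s ^ 2))" by simp
  qed (use CARD_field_gt_1 pos in \<open>auto simp: prod_pos\<close>)
  obtain q k where q: "0 < q" and k: "\<And>s. s < S \<Longrightarrow> ?d ^ k s \<le> \<delta> s ^ (2 * q)"
    and k_ge: "\<And>s. s < S \<Longrightarrow> q * (L * m s) \<le> k s"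
    and k_sum: "q * (L * ((\<Sum>s<S. m s) + ?c)) \<le> (\<Sum>s<S. k s)"
    using ex_round_down_powers[OF prime_CHAR_finite_field r pos low prod] by blast
  define n where "n = q * L"
  define e where "e s = k s - n * m s" for s
  have k_eq: "k s = n * m s + e s" if "s < S" for s
    using k_ge[OF that] by (simp add: e_def n_def mult.assoc)
  have "n * (\<Sum>s<S. m s) + n * ?c \<le> (\<Sum>s<S. n * m s + e s)"
    using k_sum k_eq by (simp add: n_def distrib_left mult.assoc)
  then have e: "n * ?c \<le> (\<Sum>s<S. e s)" by (simp add: sum.distrib sum_distrib_left)
  obtain \<rho> U N M dec where "successful_scheme S K m V (2 * n) (\<lambda>s. \<delta> s ^ (2 * q)) \<rho> U N M dec"
    using ex_successful_scheme[where V = V and K = K and m = m and S = S and n = n and e = e and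
        \<delta> = "\<lambda>s. \<delta> s ^ (2 * q)", OF V] k k_eq e by auto
  moreover have "log (real ?d) (real (\<delta> s ^ (2 * q))) = real (2 * n) * \<Delta> s" if "s < S" for s
    unfolding log_\<delta>[OF that] n_def by (simp add: mult_ac)
  moreover have "1 \<le> 2 * n" using q L by (simp add: n_def)
  ultimately show ?thesis unfolding achievable_tuple_def by blast
qed

theorem theorem1:
  fixes S K :: nat and m :: "nat \<Rightarrow> nat" and V :: "nat \<Rightarrow> 'a::{finite,field} mat"
  assumes "1 \<le> S" and "1 \<le> K" and "\<And>s. s < S \<Longrightarrow> 1 \<le> m s"
    and "\<And>s. s < S \<Longrightarrow> V s \<in> carrier_mat K (m s)"
    and "\<And>s. s < S \<Longrightarrow> vec_space.rank K (V s) = m s"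
    and "vec_space.rank K (hconcat K S V) = K"
  shows "achievable_region S K m V (D_LC S K m V) \<and> achievable_rate S K m V (R_LC S K m V)"
proof
  show "achievable_region S K m V (D_LC S K m V)"
    unfolding achievable_region_def using achievable_tuple_if_D_LC assms(4) by blast
  let ?d = "CARD('a)" and ?c = "c_min S K m V"
  \<comment> \<open>A tuple on the boundary of the region, represented with two instances; all
    auxiliary qudits are charged to server 0, which exists since \<open>1 \<le> S\<close>.\<close>
  define a where "a s = m s + (if s = 0 then ?c else 0)" for s
  define \<Delta> where "\<Delta> s = real (a s) / 2" for s
  have sum: "(\<Sum>s<S. a s) = (\<Sum>s<S. m s) + ?c"
    using assms(1) by (simp add: a_def sum.distrib)
  have "(\<Sum>s<S. \<Delta> s) = real (\<Sum>s<S. a s) / 2" by (simp add: \<Delta>_def sum_divide_distrib)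
  then have sum_\<Delta>: "(\<Sum>s<S. \<Delta> s) = (real (\<Sum>s<S. m s) + real ?c) / 2" by (simp add: sum)
  have tuple: "download_cost_tuple ?d S \<Delta>"
    unfolding download_cost_tuple_def
  proof (intro exI conjI allI impI)
    show "1 \<le> (2 :: nat)" by simp
    fix s
    show "0 < ?d ^ a s" by simp
    show "\<Delta> s = log (real ?d) (real (?d ^ a s)) / real 2"
      using CARD_field_gt_1[where 'a = 'a] by (simp add: \<Delta>_def log_nat_power)
  qed
  have "\<Delta> \<in> D_LC S K m V"
    unfolding D_LC_def
  proof (intro CollectI conjI allI impI)
    show "real (\<Sum>s<S. m s) + real ?c \<le> (\<Sum>s<S. 2 * \<Delta> s)"
      unfolding sum_distrib_left[symmetric] sum_\<Delta> by simp
  qed (simp_all add: \<Delta>_def a_def)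
  with tuple assms(4) have "achievable_tuple S K m V \<Delta>"
    using achievable_tuple_if_D_LC by blast
  moreover have "0 < (\<Sum>s<S. \<Delta> s)"
  proof -
    have "1 \<le> m 0" using assms(1,3) by simp
    also have "m 0 \<le> (\<Sum>s<S. m s)" using assms(1) by (intro member_le_sum) auto
    finally have "0 < real (\<Sum>s<S. m s)" by (subst of_nat_0_less_iff) simp
    then show ?thesis unfolding sum_\<Delta> by (simp del: of_nat_sum)
  qed
  moreover have "R_LC S K m V = real K / (\<Sum>s<S. \<Delta> s)"
    unfolding sum_\<Delta> by (simp add: R_LC_def)
  ultimately show "achievable_rate S K m V (R_LC S K m V)"
    unfolding achievable_rate_def using tuple by blast
qed

end
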